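(* Let $A,B\in\mathbb{C}_{n,n}$. Then the following are equivalent: (i) $A\overset{(\dag)}{\le}B$, i.e. $A^{(\dag)}A=A^{(\dag)}B$ and $AA^{(\dag)}=BA^{(\dag)}$; (ii) there exists a unitary matrix $U$ such that $$A=U\begin{bmatrix}T_1&T_2&S_1\\0&N_{11}&N_{12}\\0&N_{13}&N_{14}\end{bmatrix}U^\ast,\qquad B=U\begin{bmatrix}T_1&T_2&S_1\\0&T_3&S_2\\0&0&N_2\end{bmatrix}U^\ast$$ (conformal partitions with square diagonal blocks), where $\begin{bmatrix}N_{11}&N_{12}\\N_{13}&N_{14}\end{bmatrix}$ and $N_2$ are nilpotent, and $T_1$ and $T_3$ are non-singular; (iii) $A^{k+1}=BA^k$ and $A^\ast A^k=B^\ast A^k$, where $k$ is the index of $A$; (iv) $VAV^\ast\overset{(\dag)}{\le}VBV^\ast$ for each unitary matrix $V\in\mathbb{C}_{n,n}$; (v) $A_1\overset{(\#)}{\le}B_1$, where $A=A_1+A_2$ and $B=B_1+B_2$ are the core-EP decompositions of $A$ and $B$, respectively, with $A_1,B_1$ core-invertible and $A_2,B_2$ nilpotent.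
   Context: $\mathbb{C}_{n,n}$ is the set of $n\times n$ complex matrices, $A^\ast$ is the conjugate transpose, $\mathrm{rk}$ the rank, $\mathcal{R}(A)$ the column space, $A^\dag$ the Moore-Penrose inverse. The index $\mathrm{Ind}(A)$ is $0$ if $A$ is non-singular, and otherwise is the smallest positive integer $k$ with $\mathrm{rk}(A^{k+1})=\mathrm{rk}(A^k)$. $\mathbb{C}_n^{\mathtt{CM}}=\{A\in\mathbb{C}_{n,n} : \mathrm{rk}(A^2)=\mathrm{rk}(A)\}$ (core-invertible matrices). Blocks in partitioned matrices may be empty. Core-EP decomposition: for $A\in\mathbb{C}_{n,n}$ with $\mathrm{Ind}(A)=k$, it is the (existing and unique) decomposition $A=A_1+A_2$ with $A_1\in\mathbb{C}_n^{\mathtt{CM}}$, $A_2^k=0$ (read as $A_2=0$ when $k=0$), and $A_1^\ast A_2=A_2A_1=0$. Core inverse: for $A\in\mathbb{C}_n^{\mathtt{CM}}$, $A^{(\#)}$ is the unique $X\in\mathbb{C}_{n,n}$ with $AX=AA^\dag$ and $\mathcal{R}(X)\subseteq\mathcal{R}(A)$. Core partial order: for $A,B\in\mathbb{C}_n^{\mathtt{CM}}$, $A\overset{(\#)}{\le}B$ means $A^{(\#)}A=A^{(\#)}B$ and $AA^{(\#)}=BA^{(\#)}$. Core-EP inverse: for $A\in\mathbb{C}_{n,n}$ with $\mathrm{Ind}(A)=k$, $A^{(\dag)}$ is the unique $X\in\mathbb{C}_{n,n}$ satisfying $XA^{k+1}=A^k$, $XAX=X$, $(AX)^\ast=AX$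 and $\mathcal{R}(X)\subseteq\mathcal{R}(A^k)$. Core-EP order: for $A,B\in\mathbb{C}_{n,n}$, $A\overset{(\dag)}{\le}B$ means $A^{(\dag)}A=A^{(\dag)}B$ and $AA^{(\dag)}=BA^{(\dag)}$. *)

theory Defs
  imports "Jordan_Normal_Form.DL_Rank" "Jordan_Normal_Form.Schur_Decomposition"
begin

abbreviation mat_rank :: "complex mat \<Rightarrow> nat" where
  "mat_rank A \<equiv> vec_space.rank (dim_row A) A"

abbreviation mat_range :: "complex mat \<Rightarrow> complex vec set" where
  "mat_range A \<equiv> vec_space.col_space (dim_row A) A"

definition unitary_mat :: "complex mat \<Rightarrow> bool" where
  "unitary_mat U \<longleftrightarrow>
     square_mat U \<and> inverts_mat U (mat_adjoint U) \<and> inverts_mat (mat_adjoint U) U"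

definition nilpotent_mat :: "complex mat \<Rightarrow> bool" where
  "nilpotent_mat A \<longleftrightarrow> square_mat A \<and> (\<exists>m. A ^\<^sub>m m = 0\<^sub>m (dim_row A) (dim_row A))"

definition mat_index :: "complex mat \<Rightarrow> nat" where
  "mat_index A =
     (if invertible_mat A then 0
      else LEAST k. 0 < k \<and> mat_rank (A ^\<^sub>m (k + 1)) = mat_rank (A ^\<^sub>m k))"

definition core_invertible :: "nat \<Rightarrow> complex mat set" where
  "core_invertible n = {A \<in> carrier_mat n n. mat_rank (A ^\<^sub>m 2) = mat_rank A}"

definition mp_inverse :: "complex mat \<Rightarrow> complex mat" where
  "mp_inverse A = (THE X. X \<in> carrier_mat (dim_col A) (dim_row A) \<and>
     A * X * A = A \<and> X * A * X = X \<and>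
     mat_adjoint (A * X) = A * X \<and> mat_adjoint (X * A) = X * A)"

text \<open>This is a genuine description only for core-invertible \<open>A\<close>; all other values are unspecified.\<close>

definition core_inverse :: "complex mat \<Rightarrow> complex mat" where
  "core_inverse A = (THE X. X \<in> carrier_mat (dim_row A) (dim_row A) \<and>
     A * X = A * mp_inverse A \<and> mat_range X \<subseteq> mat_range A)"

definition core_le :: "nat \<Rightarrow> complex mat \<Rightarrow> complex mat \<Rightarrow> bool" where
  "core_le n A B \<longleftrightarrow> A \<in> core_invertible n \<and> B \<in> core_invertible n \<and>
     core_inverse A * A = core_inverse A * B \<and> A * core_inverse A = B * core_inverse A"

text \<open>
  For index \<open>0\<close> the condition \<open>A2 ^\<^sub>m mat_index A = 0\<close> is read as \<open>A2 = 0\<close>, since a zeroth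
  power is the identity matrix.
\<close>

definition core_ep_decomposition ::
    "nat \<Rightarrow> complex mat \<Rightarrow> complex mat \<Rightarrow> complex mat \<Rightarrow> bool" where
  "core_ep_decomposition n A A1 A2 \<longleftrightarrow>
     A1 \<in> core_invertible n \<and> A2 \<in> carrier_mat n n \<and> A = A1 + A2 \<and>
     (if mat_index A = 0 then A2 = 0\<^sub>m n n else A2 ^\<^sub>m mat_index A = 0\<^sub>m n n) \<and>
     mat_adjoint A1 * A2 = 0\<^sub>m n n \<and> A2 * A1 = 0\<^sub>m n n"

definition core_ep_inverse :: "complex mat \<Rightarrow> complex mat" where
  "core_ep_inverse A = (THE X. X \<in> carrier_mat (dim_row A) (dim_row A) \<and>
     X * A ^\<^sub>m (mat_index A + 1) = A ^\<^sub>m mat_index A \<and>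
     X * A * X = X \<and> mat_adjoint (A * X) = A * X \<and>
     mat_range X \<subseteq> mat_range (A ^\<^sub>m mat_index A))"

definition core_ep_le :: "complex mat \<Rightarrow> complex mat \<Rightarrow> bool" where
  "core_ep_le A B \<longleftrightarrow>
     core_ep_inverse A * A = core_ep_inverse A * B \<and>
     A * core_ep_inverse A = B * core_ep_inverse A"

text \<open>The column analogue of \<^const>\<open>append_rows\<close>.\<close>

definition append_cols :: "complex mat \<Rightarrow> complex mat \<Rightarrow> complex mat" where
  "append_cols A B = four_block_mat A B (0\<^sub>m 0 (dim_col A)) (0\<^sub>m 0 (dim_col B))"

text \<open>
  The \<open>3 \<times> 3\<close> block matrix with the blocks given row by row; it is meaningful only when
  the block sizes conform. Blocks may have zero rows or columns.
\<close>

definition nine_block_mat ::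
    "complex mat \<Rightarrow> complex mat \<Rightarrow> complex mat \<Rightarrow>
     complex mat \<Rightarrow> complex mat \<Rightarrow> complex mat \<Rightarrow>
     complex mat \<Rightarrow> complex mat \<Rightarrow> complex mat \<Rightarrow> complex mat" where
  "nine_block_mat A11 A12 A13 A21 A22 A23 A31 A32 A33 =
     four_block_mat A11 (append_cols A12 A13)
                    (A21 @\<^sub>r A31) (four_block_mat A22 A23 A32 A33)"

end

theory Submission
  imports Defs "Jordan_Normal_Form.Spectral_Radius"
begin

text \<open>
  Deflating the non-zero eigenvalues one at a time puts every square matrix into the form
  \<open>A = U [[T, S], [0, N]] U\<^sup>*\<close> with \<open>U\<close> unitary, \<open>T\<close> non-singular and \<open>N\<close> nilpotent. Then
  \<open>X = U [[T\<^sup>-\<^sup>1, 0], [0, 0]] U\<^sup>*\<close> is the core-EP inverse of \<open>A\<close>. Comparing blocks in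
  \<open>X A = X B\<close> and \<open>A X = B X\<close> shows that \<open>B\<close> has the same first block row and a zero block
  below \<open>T\<close>; reducing its remaining diagonal block in the same way gives (ii).

  Everything else follows from identities for \<open>X\<close> alone. The matrix \<open>A X\<close> is a Hermitian
  idempotent with \<open>A X A\<^sup>k = A\<^sup>k\<close>, and \<open>X = A\<^sup>k Z\<close> for some \<open>Z\<close>, which yields (iii). The core part
  of the core-EP decomposition is \<open>A\<^sub>1 = A X A\<close>, and \<open>X\<close> is also the core inverse of \<open>A\<^sub>1\<close>,
  which reduces (v) to (i).
\<close>

subsection \<open>Adjoints, powers and ranges\<close>

text \<open>\<open>core_ep_inverse\<close> and \<open>core_inverse\<close> are definite descriptions
  that involve the index and column spaces, and the index is itself defined by ranks. None of these
  is computed from the block form. Range inclusions and rank equalities become factorizations, and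
  the index k enters only through \<open>A^k = A^(k+1) Y\<close>. A solution X of the index-free
  conditions comes with some unknown exponent, and this factorization moves it to k. Uniqueness
  rests on one observation: A X and A Y are Hermitian, and if each fixes the range of the other,
  they coincide. Non-zero eigenvalues are deflated first because T has to collect exactly these;
  once none is left, the trailing block is nilpotent as a whole. In (ii) the block of B that the
  order leaves free is reduced by a second unitary matrix, which must act on A as well. This is why
  the nilpotent part of A is a full 2 x 2 array while that of B is triangular.\<close>

lemma mat_adjoint_dim [simp]:
  "dim_row (mat_adjoint A) = dim_col A" "dim_col (mat_adjoint A) = dim_row A"
  by (simp_all add: mat_adjoint_def)

lemma mat_adjoint_carrier [simp, intro]:
  "A \<in> carrier_mat n m \<Longrightarrow> mat_adjoint A \<in> carrier_mat m n"
  by auto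

lemma index_mat_adjoint [simp]:
  fixes A :: "complex mat"
  shows "i < dim_col A \<Longrightarrow> j < dim_row A \<Longrightarrow> mat_adjoint A $$ (i, j) = cnj (A $$ (j, i))"
  by (simp add: mat_adjoint_def mat_of_rows_def)

lemma mat_adjoint_mult:
  fixes A B :: "complex mat"
  assumes "A \<in> carrier_mat n m" "B \<in> carrier_mat m p"
  shows "mat_adjoint (A * B) = mat_adjoint B * mat_adjoint A"
  using assms by (intro eq_matI) (auto simp: scalar_prod_def mult.commute intro!: sum.cong)

lemma mat_adjoint_adjoint [simp]:
  fixes A :: "complex mat"
  shows "mat_adjoint (mat_adjoint A) = A"
  by (intro eq_matI) auto

lemma mat_adjoint_one [simp]: "mat_adjoint (1\<^sub>m n :: complex mat) = 1\<^sub>m n"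
  by (intro eq_matI) auto

lemma mat_adjoint_zero [simp]: "mat_adjoint (0\<^sub>m n m :: complex mat) = 0\<^sub>m m n"
  by (intro eq_matI) auto

lemma mat_adjoint_four_block:
  fixes A B C D :: "complex mat"
  assumes "A \<in> carrier_mat n1 m1" "B \<in> carrier_mat n1 m2"
    "C \<in> carrier_mat n2 m1" "D \<in> carrier_mat n2 m2"
  shows "mat_adjoint (four_block_mat A B C D) =
    four_block_mat (mat_adjoint A) (mat_adjoint C) (mat_adjoint B) (mat_adjoint D)"
  using assms by (intro eq_matI) auto

lemma unitary_matD:
  assumes "U \<in> carrier_mat n n" "unitary_mat U"
  shows "U * mat_adjoint U = 1\<^sub>m n" "mat_adjoint U * U = 1\<^sub>m n"
  using assms by (auto simp: unitary_mat_def inverts_mat_def)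

lemma unitary_matI:
  assumes "U \<in> carrier_mat n n" "mat_adjoint U * U = 1\<^sub>m n"
  shows "unitary_mat U"
  using assms mat_mult_left_right_inverse[of "mat_adjoint U" n U]
  by (auto simp: unitary_mat_def inverts_mat_def)

lemma unitary_mat_mult:
  assumes "U \<in> carrier_mat n n" "unitary_mat U" "V \<in> carrier_mat n n" "unitary_mat V"
  shows "unitary_mat (U * V)"
proof (rule unitary_matI)
  have "mat_adjoint (U * V) * (U * V) = mat_adjoint V * (mat_adjoint U * U) * V"
    using assms by (simp add: mat_adjoint_mult assoc_mult_mat[of _ n n _ n _ n] mult_carrier_mat[of _ n n _ n])
  then show "mat_adjoint (U * V) * (U * V) = 1\<^sub>m n"
    using assms by (simp add: unitary_matD)
qed (use assms in auto)

section \<open>Column spaces and rank\<close>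

lemma mat_range_iff:
  assumes "A \<in> carrier_mat n m"
  shows "y \<in> mat_range A \<longleftrightarrow> (\<exists>x \<in> carrier_vec m. y = A *\<^sub>v x)"
  using vec_space.col_space_eq[of A n m] assms by auto

text \<open>Preimages under \<open>Q\<close> of the columns of \<open>P\<close> are the columns of
  \<open>Z\<close>. Through this equivalence the later arguments about ranges become computations
  with matrix products.\<close>

lemma mat_range_subset_iff:
  assumes P: "P \<in> carrier_mat n p" and Q: "Q \<in> carrier_mat n q"
  shows "mat_range P \<subseteq> mat_range Q \<longleftrightarrow> (\<exists>Z \<in> carrier_mat q p. P = Q * Z)"
proof
  assume sub: "mat_range P \<subseteq> mat_range Q"
  have "\<exists>x \<in> carrier_vec q. col P j = Q *\<^sub>v x" if "j < p" for j
  proof -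
    have "col P j = P *\<^sub>v unit_vec p j"
      using P that by (intro eq_vecI) auto
    then have "col P j \<in> mat_range P"
      using mat_range_iff[OF P] by auto
    then show ?thesis using sub mat_range_iff[OF Q] by auto
  qed
  then obtain x where x: "\<And>j. j < p \<Longrightarrow> x j \<in> carrier_vec q \<and> col P j = Q *\<^sub>v x j"
    by metis
  define Z where "Z = mat_of_cols q (map x [0..<p])"
  have Z: "Z \<in> carrier_mat q p" unfolding Z_def by (rule carrier_matI) auto
  have "P = Q * Z"
  proof (rule mat_col_eqI)
    fix j assume "j < dim_col (Q * Z)"
    then have j: "j < p" using Z by auto
    have "col (Q * Z) j = Q *\<^sub>v col Z j" using Q Z j by auto
    also have "col Z j = x j" using x[OF j] j unfolding Z_def by (subst col_mat_of_cols) auto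
    finally show "col P j = col (Q * Z) j" using x[OF j] by simp
  qed (use P Q Z in auto)
  then show "\<exists>Z \<in> carrier_mat q p. P = Q * Z" using Z by blast
next
  assume "\<exists>Z \<in> carrier_mat q p. P = Q * Z"
  then obtain Z where Z: "Z \<in> carrier_mat q p" "P = Q * Z" by blast
  show "mat_range P \<subseteq> mat_range Q"
  proof
    fix y assume "y \<in> mat_range P"
    then obtain x where "x \<in> carrier_vec p" "y = P *\<^sub>v x" using mat_range_iff[OF P] by auto
    then have "Z *\<^sub>v x \<in> carrier_vec q" "y = Q *\<^sub>v (Z *\<^sub>v x)" using Z Q by auto
    then show "y \<in> mat_range Q" using mat_range_iff[OF Q] by blast
  qed
qed

lemma rank_eq_if_range_eq:
  assumes "P \<in> carrier_mat n p" "Q \<in> carrier_mat n q" "mat_range P = mat_range Q"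
  shows "mat_rank P = mat_rank Q"
  using assms by (auto simp: vec_space.rank_def vec_space.col_space_def)

text \<open>A maximal independent set of columns of \<open>P\<close> has rank-many elements and lies
  in the column space of \<open>Q\<close>, whose dimension is the same number; hence it is a basis
  there.\<close>

lemma range_eq_if_rank_eq:
  assumes P: "P \<in> carrier_mat n p" and Q: "Q \<in> carrier_mat n q"
    and sub: "mat_range P \<subseteq> mat_range Q" and rank: "mat_rank P = mat_rank Q"
  shows "mat_range P = mat_range Q"
proof -
  interpret V: vec_space "TYPE(complex)" n .
  define W where "W = V.span (set (cols Q))"
  have cQ: "set (cols Q) \<subseteq> carrier_vec n" using Q cols_dim[of Q] by auto
  have cP: "set (cols P) \<subseteq> carrier_vec n" using P cols_dim[of P] by auto
  have subW: "VectorSpace.subspace class_ring W V.V" unfolding W_def by (rule V.span_is_subspace[OF cQ])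
  \<comment> \<open>The dimension count takes place in \<open>W\<close> as a vector space of its
    own, so independence and span are carried between \<open>W\<close> and the ambient space
    below.\<close>
  interpret W: vectorspace class_ring "V.vs W" by (rule V.subspace_is_vs[OF subW])
  have fin: "W.fin_dim"
    unfolding W_def by (rule V.fin_dim_span) (use cQ in auto)
  have "\<exists>S. finite S \<and> maximal S (\<lambda>T. T \<subseteq> set (cols P) \<and> V.lin_indpt T)"
  proof (rule maximal_exists)
    show "finite T \<and> card T \<le> card (set (cols P))"
      if "T \<subseteq> set (cols P) \<and> V.lin_indpt T" for T
      using that by (auto intro: finite_subset card_mono)
    show "{} \<subseteq> set (cols P) \<and> V.lin_indpt {}"
      by (auto simp: V.lin_dep_def)
  qed
  then obtain S where S: "maximal S (\<lambda>T. T \<subseteq> set (cols P) \<and> V.lin_indpt T)"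
    by blast
  have SP: "S \<subseteq> set (cols P)" and li: "V.lin_indpt S"
    using S by (auto simp: maximal_def)
  have cPW: "set (cols P) \<subseteq> W"
    using sub V.in_own_span[OF cP] P Q
    by (auto simp: W_def vec_space.col_space_def)
  have "card S = V.rank Q"
    using V.rank_card_indpt[OF P S] rank P Q by simp
  then have "card S = W.dim"
    by (simp add: V.rank_def W_def)
  moreover have "W.lin_indpt S"
    using V.span_li_not_depend(2)[of S W] SP cPW li subW by (auto simp: VectorSpace.subspace_def)
  ultimately have "W.basis S"
    using W.dim_li_is_basis[OF fin finite_subset[OF SP]] SP cPW by auto
  then have "W.span S = W" by (simp add: W.basis_def)
  then have "V.span S = W"
    using V.span_li_not_depend(1)[of S W] SP cPW subW by (auto simp: VectorSpace.subspace_def)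
  then have "W \<subseteq> V.span (set (cols P))" using V.span_is_monotone[OF SP] by simp
  then show ?thesis using sub P Q by (auto simp: W_def vec_space.col_space_def)
qed

lemma pow_mat_Suc_left:
  assumes "(A :: complex mat) \<in> carrier_mat n n"
  shows "A ^\<^sub>m Suc k = A * A ^\<^sub>m k"
proof (induction k)
  case (Suc k)
  have "A ^\<^sub>m Suc (Suc k) = (A * A ^\<^sub>m k) * A"
    using Suc by simp
  then show ?case
    using assms by (simp add: assoc_mult_mat[of _ n n _ n _ n] mult_carrier_mat[of _ n n _ n])
qed (use assms in auto)

lemma pow_mat_plus:
  assumes "(A :: complex mat) \<in> carrier_mat n n"
  shows "A ^\<^sub>m (k + l) = A ^\<^sub>m k * A ^\<^sub>m l"
proof (induction l)
  case (Suc l)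
  then show ?case
    using assms by (simp add: assoc_mult_mat[of _ n n _ n _ n] mult_carrier_mat[of _ n n _ n])
qed (use assms in auto)

subsection \<open>Unitary reduction to core and nilpotent blocks\<close>

lemma det_nonzero_iff_inverse:
  assumes "(A :: complex mat) \<in> carrier_mat n n"
  shows "det A \<noteq> 0 \<longleftrightarrow> (\<exists>B \<in> carrier_mat n n. A * B = 1\<^sub>m n \<and> B * A = 1\<^sub>m n)"
proof
  assume "det A \<noteq> 0"
  from det_non_zero_imp_unit[OF assms this, of "()"]
  show "\<exists>B \<in> carrier_mat n n. A * B = 1\<^sub>m n \<and> B * A = 1\<^sub>m n"
    by (auto simp: Units_def ring_mat_def)
next
  assume "\<exists>B \<in> carrier_mat n n. A * B = 1\<^sub>m n \<and> B * A = 1\<^sub>m n"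
  then obtain B where "B \<in> carrier_mat n n" "A * B = 1\<^sub>m n" by blast
  then have "det A * det B = 1" using det_mult[of A n B] assms by simp
  then show "det A \<noteq> 0" by auto
qed

lemma invertible_mat_iff_inverse:
  assumes "A \<in> carrier_mat n n"
  shows "invertible_mat A \<longleftrightarrow> (\<exists>B \<in> carrier_mat n n. A * B = 1\<^sub>m n \<and> B * A = 1\<^sub>m n)"
proof
  assume "invertible_mat A"
  then obtain B where B: "A * B = 1\<^sub>m n" "B * A = 1\<^sub>m (dim_row B)"
    using assms by (auto simp: invertible_mat_def inverts_mat_def)
  have "dim_col B = n" using arg_cong[OF B(1), of dim_col] by simp
  moreover have "dim_row B = n" using arg_cong[OF B(2), of dim_col] assms by simp
  ultimately show "\<exists>B \<in> carrier_mat n n. A * B = 1\<^sub>m n \<and> B * A = 1\<^sub>m n" using B by auto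
qed (use assms in \<open>auto simp: invertible_mat_def inverts_mat_def\<close>)

lemma four_block_split:
  fixes M :: "complex mat"
  assumes "M \<in> carrier_mat (a + b) (c + d)"
  obtains P Q R S where "P \<in> carrier_mat a c" "Q \<in> carrier_mat a d"
    "R \<in> carrier_mat b c" "S \<in> carrier_mat b d" "M = four_block_mat P Q R S"
  using assms split_block[of M a c _ _ _ _ b d]
  by (cases "split_block M a c") auto

lemma unitary_conj_pow:
  assumes U: "U \<in> carrier_mat n n" "unitary_mat U" and B: "B \<in> carrier_mat n n"
  shows "(U * B * mat_adjoint U) ^\<^sub>m k = U * B ^\<^sub>m k * mat_adjoint U"
proof -
  have "similar_mat_wit (U * B * mat_adjoint U) B U (mat_adjoint U)"
    using U B unitary_matD[OF U] by (intro similar_mat_witI[of _ _ n]) auto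
  then show ?thesis by (rule similar_mat_wit_pow_id)
qed

lemma unitary_conj_cancel:
  assumes U: "U \<in> carrier_mat n n" "unitary_mat U" and K: "K \<in> carrier_mat n n"
  shows "mat_adjoint U * (U * K * mat_adjoint U) * U = (K :: complex mat)"
proof -
  have "mat_adjoint U * (U * K * mat_adjoint U) * U = mat_adjoint U * U * K * (mat_adjoint U * U)"
    using U K by (simp add: assoc_mult_mat[of _ n n _ n _ n] mult_carrier_mat[of _ n n _ n])
  then show ?thesis using K unfolding unitary_matD[OF U] by simp
qed

lemma unitary_conj_mult:
  fixes U M N :: "complex mat"
  assumes "U \<in> carrier_mat n n" "unitary_mat U" "M \<in> carrier_mat n n" "N \<in> carrier_mat n n"
  shows "(U * M * mat_adjoint U) * (U * N * mat_adjoint U) = U * (M * N) * mat_adjoint U"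
proof -
  have "U * M * mat_adjoint U * (U * N * mat_adjoint U) =
      U * M * (mat_adjoint U * U) * N * mat_adjoint U"
    using assms by (simp add: assoc_mult_mat[of _ n n _ n _ n] mult_carrier_mat[of _ n n _ n])
  then show ?thesis
    using assms unfolding unitary_matD[OF assms(1,2)]
    by (simp add: assoc_mult_mat[of _ n n _ n _ n] mult_carrier_mat[of _ n n _ n])
qed

lemma unitary_conj_inject:
  fixes U M N :: "complex mat"
  assumes U: "U \<in> carrier_mat n n" "unitary_mat U" and M: "M \<in> carrier_mat n n"
    and N: "N \<in> carrier_mat n n" and eq: "U * M * mat_adjoint U = U * N * mat_adjoint U"
  shows "M = N"
proof -
  have "M = mat_adjoint U * (U * M * mat_adjoint U) * U" by (rule unitary_conj_cancel[OF U M, symmetric])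
  also have "\<dots> = N" unfolding eq by (rule unitary_conj_cancel[OF U N])
  finally show ?thesis .
qed

section \<open>Deflation of eigenvalues\<close>

text \<open>Gram-Schmidt applied to a basis that starts with \<open>v\<close> keeps \<open>v\<close>
  in front; normalizing the resulting vectors gives the columns of \<open>U\<close>, and
  \<open>c\<close> is the reciprocal of the norm of \<open>v\<close>.\<close>

lemma unitary_with_first_column:
  assumes v: "v \<in> carrier_vec n" "v \<noteq> 0\<^sub>v n"
  shows "\<exists>U c. U \<in> carrier_mat n n \<and> unitary_mat U \<and> c \<noteq> 0 \<and> col U 0 = c \<cdot>\<^sub>v (v :: complex vec)"
proof -
  interpret cof_vec_space n "TYPE(complex)" .
  note bc = basis_completion[OF v]
  have "n \<noteq> 0" using v by auto
  then obtain vs where vs: "basis_completion v = v # vs"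
    using bc(6,7) by (cases "basis_completion v") auto
  define ws where "ws = gram_schmidt n (basis_completion v)"
  have ws: "set ws \<subseteq> carrier_vec n" "corthogonal ws" "length ws = n"
    using gram_schmidt_result[OF bc(2,4,5) ws_def] bc(6) by auto
  have hd: "ws ! 0 = v"
    using gram_schmidt_hd[OF v(1), of vs] ws(3) \<open>n \<noteq> 0\<close> vs
    by (metis hd_conv_nth length_0_conv ws_def)
  \<comment> \<open>Gram-Schmidt yields orthogonal vectors that are not normalized. Their squared
    norms are complex numbers known to be non-negative; \<open>q\<close> extracts them as reals so
    that a square root can be taken.\<close>
  define q where "q i = Re (ws ! i \<bullet>c ws ! i)" for i
  have wsi: "ws ! i \<in> carrier_vec n" if "i < n" for i using ws that by auto
  have q: "q i > 0 \<and> ws ! i \<bullet>c ws ! i = complex_of_real (q i)" if "i < n" for i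
  proof -
    have "ws ! i \<bullet>c ws ! i \<ge> 0" by (rule conjugate_square_ge_0_vec)
    moreover have "ws ! i \<bullet>c ws ! i \<noteq> 0" using corthogonalD[OF ws(2), of i i] ws(3) that by auto
    ultimately show ?thesis by (auto simp: q_def less_eq_complex_def complex_eq_iff)
  qed
  define d where "d i = complex_of_real (1 / sqrt (q i))" for i
  define U where "U = mat n n (\<lambda>(i, j). d j * (ws ! j) $ i)"
  have U: "U \<in> carrier_mat n n" by (simp add: U_def)
  have col: "col U j = d j \<cdot>\<^sub>v (ws ! j)" if "j < n" for j
    using wsi[OF that] that by (intro eq_vecI) (auto simp: U_def)
  have "mat_adjoint U * U = 1\<^sub>m n"
  proof (rule eq_matI)
    fix i j assume "i < dim_row (1\<^sub>m n :: complex mat)" "j < dim_col (1\<^sub>m n :: complex mat)"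
    then have ij: "i < n" "j < n" by auto
    have "(mat_adjoint U * U) $$ (i, j) = (\<Sum>k<n. cnj (U $$ (k, i)) * U $$ (k, j))"
      using U ij by (auto simp: scalar_prod_def atLeast0LessThan intro!: sum.cong)
    also have "\<dots> = (\<Sum>k<n. d i * d j * (ws ! j $ k * cnj (ws ! i $ k)))"
      using ij by (intro sum.cong) (auto simp: U_def d_def)
    also have "\<dots> = d i * d j * (ws ! j \<bullet>c ws ! i)"
      using wsi[OF ij(1)] wsi[OF ij(2)]
      by (auto simp: scalar_prod_def atLeast0LessThan sum_distrib_left intro!: sum.cong)
    also have "\<dots> = 1\<^sub>m n $$ (i, j)"
    proof (cases "i = j")
      case True
      have "1 / sqrt (q i) * (1 / sqrt (q i)) * q i = 1" using q[OF ij(1)] by (simp add: field_simps)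
      then have "d i * d i * complex_of_real (q i) = 1"
        unfolding d_def of_real_mult[symmetric] by simp
      then show ?thesis using q[OF ij(1)] True ij by simp
    next
      case False
      then show ?thesis using corthogonalD[OF ws(2), of j i] ws(3) ij by simp
    qed
    finally show "(mat_adjoint U * U) $$ (i, j) = 1\<^sub>m n $$ (i, j)" .
  qed (use U in auto)
  moreover have "d 0 \<noteq> 0" using q[of 0] \<open>n \<noteq> 0\<close> by (simp add: d_def)
  ultimately show ?thesis
    using U unitary_matI[OF U] col[of 0] hd \<open>n \<noteq> 0\<close> by auto
qed

text \<open>If the first column of \<open>U\<close> is a multiple of an eigenvector, conjugation by
  \<open>U\<close> turns it into the first unit vector, which is then an eigenvector of the
  conjugated matrix.\<close>

lemma unitary_eigenvalue_split:
  assumes A: "A \<in> carrier_mat (Suc n) (Suc n)" and e: "eigenvalue A e"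
  obtains U b D where "U \<in> carrier_mat (Suc n) (Suc n)" "unitary_mat U"
    "b \<in> carrier_mat 1 n" "D \<in> carrier_mat n n"
    "A = U * four_block_mat (mat 1 1 (\<lambda>_. e)) b (0\<^sub>m n 1) D * mat_adjoint U"
proof -
  obtain v where v: "v \<in> carrier_vec (Suc n)" "v \<noteq> 0\<^sub>v (Suc n)" "A *\<^sub>v v = e \<cdot>\<^sub>v v"
    using e A by (auto simp: eigenvalue_def eigenvector_def)
  obtain U c where U: "U \<in> carrier_mat (Suc n) (Suc n)" "unitary_mat U"
    and c: "col U 0 = c \<cdot>\<^sub>v v"
    using unitary_with_first_column[OF v(1,2)] by blast
  note UU = unitary_matD[OF U]
  define M where "M = mat_adjoint U * A * U"
  have M: "M \<in> carrier_mat (1 + n) (1 + n)"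
    using U A by (simp add: M_def mult_carrier_mat[of _ "Suc n" "Suc n" _ "Suc n"])
  have AM: "A = U * M * mat_adjoint U"
  proof -
    have "U * M * mat_adjoint U = (U * mat_adjoint U) * A * (U * mat_adjoint U)"
      unfolding M_def using U A
      by (simp add: assoc_mult_mat[of _ "Suc n" "Suc n" _ "Suc n" _ "Suc n"]
          mult_carrier_mat[of _ "Suc n" "Suc n" _ "Suc n"])
    then show ?thesis using A by (simp add: UU)
  qed
  have "col M 0 = (mat_adjoint U * A) *\<^sub>v col U 0"
    unfolding M_def using U A by (intro col_mult2) auto
  also have "\<dots> = mat_adjoint U *\<^sub>v (A *\<^sub>v (c \<cdot>\<^sub>v v))"
    unfolding c using U A v by (intro assoc_mult_mat_vec) auto
  also have "A *\<^sub>v (c \<cdot>\<^sub>v v) = e \<cdot>\<^sub>v col U 0"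
    unfolding c using A v by (simp add: mult_mat_vec[of _ "Suc n" "Suc n"] smult_smult_assoc mult.commute)
  also have "mat_adjoint U *\<^sub>v (e \<cdot>\<^sub>v col U 0) = e \<cdot>\<^sub>v (mat_adjoint U *\<^sub>v col U 0)"
    using U by (intro mult_mat_vec) (auto intro!: carrier_vecI)
  also have "mat_adjoint U *\<^sub>v col U 0 = col (1\<^sub>m (Suc n)) 0"
    unfolding UU(2)[symmetric] using U by (intro col_mult2[symmetric]) auto
  finally have col0: "col M 0 = e \<cdot>\<^sub>v unit_vec (Suc n) 0" by simp
  obtain P b R D where blocks: "P \<in> carrier_mat 1 1" "b \<in> carrier_mat 1 n"
    "R \<in> carrier_mat n 1" "D \<in> carrier_mat n n" "M = four_block_mat P b R D"
    using four_block_split[OF M] .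
  have entries: "M $$ (i, 0) = (if i = 0 then e else 0)" if "i < Suc n" for i
    using arg_cong[OF col0, of "\<lambda>v. v $ i"] that M by auto
  have "P = mat 1 1 (\<lambda>_. e)"
    using entries[of 0] blocks by (intro eq_matI) auto
  moreover have "R = 0\<^sub>m n 1"
  proof (rule eq_matI)
    fix i j assume "i < dim_row (0\<^sub>m n 1 :: complex mat)" "j < dim_col (0\<^sub>m n 1 :: complex mat)"
    then have "i < n" "j = 0" by auto
    then show "R $$ (i, j) = 0\<^sub>m n 1 $$ (i, j)" using entries[of "Suc i"] blocks by auto
  qed (use blocks in auto)
  ultimately show ?thesis using that U blocks AM by metis
qed

text \<open>The corner block \<open>R\<close> stays unspecified: later arguments need only its size
  and the diagonal blocks.\<close>

lemma upper_block_pow: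
  fixes T S N :: "complex mat"
  assumes T: "T \<in> carrier_mat r r" and S: "S \<in> carrier_mat r s" and N: "N \<in> carrier_mat s s"
  shows "\<exists>R \<in> carrier_mat r s. four_block_mat T S (0\<^sub>m s r) N ^\<^sub>m k =
    four_block_mat (T ^\<^sub>m k) R (0\<^sub>m s r) (N ^\<^sub>m k)"
proof (induction k)
  case 0
  show ?case using T N by (intro bexI[of _ "0\<^sub>m r s"]) auto
next
  case (Suc k)
  then obtain R where R: "R \<in> carrier_mat r s" "four_block_mat T S (0\<^sub>m s r) N ^\<^sub>m k =
    four_block_mat (T ^\<^sub>m k) R (0\<^sub>m s r) (N ^\<^sub>m k)" by blast
  have "four_block_mat T S (0\<^sub>m s r) N ^\<^sub>m Suc k =
    four_block_mat (T ^\<^sub>m k) R (0\<^sub>m s r) (N ^\<^sub>m k) * four_block_mat T S (0\<^sub>m s r) N"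
    using R(2) by simp
  also have "\<dots> = four_block_mat (T ^\<^sub>m Suc k) (T ^\<^sub>m k * S + R * N) (0\<^sub>m s r) (N ^\<^sub>m Suc k)"
    using T S N R(1)
    by (subst mult_four_block_mat[of _ r r _ s _ s _ _ r _ s]) auto
  finally show ?case using T S N R(1) by (intro bexI[of _ "T ^\<^sub>m k * S + R * N"]) auto
qed

text \<open>Splitting off an eigenvalue 0 leaves a smaller block \<open>D\<close>. Its
  characteristic polynomial divides that of \<open>A\<close>, so \<open>D\<close> inherits the
  hypothesis.\<close>

lemma nilpotent_if_eigenvalues_zero:
  assumes "A \<in> carrier_mat n n" "\<And>e. eigenvalue A e \<Longrightarrow> e = (0 :: complex)"
  shows "\<exists>m. A ^\<^sub>m m = 0\<^sub>m n n"
  using assms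
proof (induction n arbitrary: A)
  case 0
  then show ?case by (intro exI[of _ 0]) auto
next
  case (Suc n)
  have "spectrum A \<noteq> {}" using spectrum_non_empty[OF Suc.prems(1)] by simp
  then have "eigenvalue A 0" using Suc.prems(2) by (auto simp: spectrum_def)
  then obtain U b D where U: "U \<in> carrier_mat (Suc n) (Suc n)" "unitary_mat U"
    and b: "b \<in> carrier_mat 1 n" and D: "D \<in> carrier_mat n n"
    and A: "A = U * four_block_mat (mat 1 1 (\<lambda>_. 0)) b (0\<^sub>m n 1) D * mat_adjoint U"
    using unitary_eigenvalue_split[OF Suc.prems(1)] by blast
  let ?Z = "mat 1 1 (\<lambda>_. 0) :: complex mat"
  let ?M = "four_block_mat ?Z b (0\<^sub>m n 1) D"
  have Z: "?Z = 0\<^sub>m 1 1" by auto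
  have M: "?M \<in> carrier_mat (Suc n) (Suc n)" using four_block_carrier_mat[of ?Z 1 1 D n n] D by simp
  have "similar_mat_wit A ?M U (mat_adjoint U)"
    using U M unitary_matD[OF U] Suc.prems(1) A by (intro similar_mat_witI[of _ _ "Suc n"]) auto
  then have "char_poly A = char_poly ?M" by (intro char_poly_similar) (auto simp: similar_mat_def)
  also have "\<dots> = char_poly ?Z * char_poly D"
    using b D by (intro char_poly_four_block_zeros_col) auto
  finally have "eigenvalue A e" if "eigenvalue D e" for e
    using that eigenvalue_root_char_poly[OF Suc.prems(1)] eigenvalue_root_char_poly[OF D] by simp
  then obtain m where m: "D ^\<^sub>m m = 0\<^sub>m n n" using Suc.IH[OF D] Suc.prems(2) by blast
  obtain R where R: "R \<in> carrier_mat 1 n"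
    "?M ^\<^sub>m m = four_block_mat (?Z ^\<^sub>m m) R (0\<^sub>m n 1) (D ^\<^sub>m m)"
    using upper_block_pow[of ?Z 1 b n D m] b D by auto
  \<comment> \<open>The extra factor is taken on the left: the zero corner of \<open>?M\<close> then
    kills the unknown \<open>R\<close>, and \<open>b\<close> meets the vanishing power of
    \<open>D\<close>.\<close>
  have "?M ^\<^sub>m Suc m = ?M * ?M ^\<^sub>m m" by (rule pow_mat_Suc_left[OF M])
  also have "\<dots> = four_block_mat (?Z * ?Z ^\<^sub>m m) (?Z * R + b * D ^\<^sub>m m) (0\<^sub>m n 1) (D * D ^\<^sub>m m)"
    unfolding R(2) using b D R(1)
    by (subst mult_four_block_mat[of _ 1 1 _ n _ n _ _ 1 _ n]) auto
  also have "\<dots> = 0\<^sub>m (Suc n) (Suc n)"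
    using b D R(1) four_block_zero_mat[of 1 1 n n] unfolding m Z by auto
  finally have "A ^\<^sub>m Suc m = 0\<^sub>m (Suc n) (Suc n)"
    unfolding A unitary_conj_pow[OF U M] using U by simp
  then show ?case by blast
qed

lemma unitary_block_diag:
  assumes V: "V \<in> carrier_mat s s" "unitary_mat V"
  shows "unitary_mat (four_block_mat (1\<^sub>m r) (0\<^sub>m r s) (0\<^sub>m s r) V)"
proof (rule unitary_matI)
  show "four_block_mat (1\<^sub>m r) (0\<^sub>m r s) (0\<^sub>m s r) V \<in> carrier_mat (r + s) (r + s)"
    using V by auto
  show "mat_adjoint (four_block_mat (1\<^sub>m r) (0\<^sub>m r s) (0\<^sub>m s r) V) *
      four_block_mat (1\<^sub>m r) (0\<^sub>m r s) (0\<^sub>m s r) V = 1\<^sub>m (r + s)"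
    using V unitary_matD[OF V]
    by (subst mat_adjoint_four_block[of _ r r _ s _ s], auto)
       (subst mult_four_block_mat[of _ r r _ s _ s _ _ r _ s], auto)
qed

lemma adjoint_conj_conj:
  fixes U V E :: "complex mat"
  assumes "U \<in> carrier_mat n n" "V \<in> carrier_mat n n" "E \<in> carrier_mat n n"
  shows "U * (V * E * mat_adjoint V) * mat_adjoint U = (U * V) * E * mat_adjoint (U * V)"
  using assms
  by (simp add: mat_adjoint_mult[of _ n n _ n] assoc_mult_mat[of _ n n _ n _ n]
      mult_carrier_mat[of _ n n _ n])

text \<open>Conjugation by \<open>diag(1, V)\<close> reduces the trailing block without disturbing
  the leading one or the zero block below it. It serves both the deflation and the simultaneous
  reduction of \<open>A\<close> and \<open>B\<close>.\<close>

lemma unitary_block_refine: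
  assumes P: "P \<in> carrier_mat r r" and Q: "Q \<in> carrier_mat r s" and D: "D \<in> carrier_mat s s"
    and U: "U \<in> carrier_mat (r + s) (r + s)" and V: "V \<in> carrier_mat s s" "unitary_mat V"
  defines "W \<equiv> U * four_block_mat (1\<^sub>m r) (0\<^sub>m r s) (0\<^sub>m s r) V"
  shows "U * four_block_mat P Q (0\<^sub>m s r) D * mat_adjoint U =
    W * four_block_mat P (Q * V) (0\<^sub>m s r) (mat_adjoint V * D * V) * mat_adjoint W"
proof -
  let ?V = "four_block_mat (1\<^sub>m r) (0\<^sub>m r s) (0\<^sub>m s r) V"
  let ?V' = "four_block_mat (1\<^sub>m r) (0\<^sub>m r s) (0\<^sub>m s r) (mat_adjoint V)"
  let ?E = "four_block_mat P (Q * V) (0\<^sub>m s r) (mat_adjoint V * D * V)"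
  note VV = unitary_matD[OF V]
  have carrier: "?V \<in> carrier_mat (r + s) (r + s)" "?V' \<in> carrier_mat (r + s) (r + s)"
    "?E \<in> carrier_mat (r + s) (r + s)" using P Q V D by auto
  have adj: "mat_adjoint ?V = ?V'"
    using V by (subst mat_adjoint_four_block[of _ r r _ s _ s]) auto
  have D1: "V * (mat_adjoint V * D * V) * mat_adjoint V = (V * mat_adjoint V) * D * (V * mat_adjoint V)"
    using V D by (simp add: assoc_mult_mat[of _ s s _ s _ s] mult_carrier_mat[of _ s s _ s])
  have Q1: "Q * V * mat_adjoint V = Q"
    using Q V VV by (subst assoc_mult_mat[of _ r s _ s _ s]) auto
  have "?V * ?E * ?V' = four_block_mat P (Q * V * mat_adjoint V) (0\<^sub>m s r)
      (V * (mat_adjoint V * D * V) * mat_adjoint V)"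
    using P Q V D
    by (subst mult_four_block_mat[of _ r r _ s _ s _ _ r _ s],
        auto simp: mult_carrier_mat[of _ s s _ s])
       (subst mult_four_block_mat[of _ r r _ s _ s _ _ r _ s],
        auto simp: mult_carrier_mat[of _ s s _ s])
  then have "?V * ?E * ?V' = four_block_mat P Q (0\<^sub>m s r) D"
    unfolding D1 Q1 using D by (simp add: VV)
  then show ?thesis
    unfolding W_def adjoint_conj_conj[OF U carrier(1,3), symmetric] adj by (simp only:)
qed

text \<open>Moves the dividing lines past \<open>T\<close>, so that a freshly deflated eigenvalue
  and \<open>T\<close> merge into one leading block.\<close>

lemma four_block_regroup:
  fixes P Q1 Q2 T S N :: "complex mat"
  assumes "P \<in> carrier_mat a a" "Q1 \<in> carrier_mat a r" "Q2 \<in> carrier_mat a s"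
    "T \<in> carrier_mat r r" "S \<in> carrier_mat r s" "N \<in> carrier_mat s s"
  shows "four_block_mat P (append_cols Q1 Q2) (0\<^sub>m (r + s) a) (four_block_mat T S (0\<^sub>m s r) N) =
    four_block_mat (four_block_mat P Q1 (0\<^sub>m r a) T) (Q2 @\<^sub>r S) (0\<^sub>m s (a + r)) N"
  using assms by (intro eq_matI) (auto simp: append_cols_def append_rows_def)

lemma append_cols_carrier [simp]:
  "A \<in> carrier_mat n r \<Longrightarrow> B \<in> carrier_mat n s \<Longrightarrow> append_cols A B \<in> carrier_mat n (r + s)"
  by (intro carrier_matI) (simp_all add: append_cols_def)

lemma append_cols_split:
  fixes M :: "complex mat"
  assumes "M \<in> carrier_mat n (r + s)"
  obtains A B where "A \<in> carrier_mat n r" "B \<in> carrier_mat n s" "M = append_cols A B"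
proof -
  have "M \<in> carrier_mat (n + 0) (r + s)" using assms by simp
  then obtain A B C D where AB: "A \<in> carrier_mat n r" "B \<in> carrier_mat n s"
    and CD: "C \<in> carrier_mat 0 r" "D \<in> carrier_mat 0 s" and M: "M = four_block_mat A B C D"
    by (rule four_block_split)
  have "C = 0\<^sub>m 0 r" "D = 0\<^sub>m 0 s" using CD by (auto intro!: eq_matI)
  then have "M = append_cols A B" using AB M by (simp add: append_cols_def)
  then show ?thesis using that AB by blast
qed

text \<open>The order of the eigenvalues is enforced by choosing a non-zero one as long as there is
  any. Of the triangular structure of \<open>T\<close> only the determinant is recorded, which is
  multiplied by the chosen eigenvalue at each stage.\<close>

lemma core_nilpotent_unitary_form:
  assumes "A \<in> carrier_mat n n"
  shows "\<exists>U r s T S N m. U \<in> carrier_mat n n \<and> unitary_mat U \<and> r + s = n \<and>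
    T \<in> carrier_mat r r \<and> S \<in> carrier_mat r s \<and> N \<in> carrier_mat s s \<and>
    det T \<noteq> (0 :: complex) \<and> N ^\<^sub>m m = 0\<^sub>m s s \<and>
    A = U * four_block_mat T S (0\<^sub>m s r) N * mat_adjoint U"
  using assms
proof (induction n arbitrary: A)
  case 0
  then show ?case
    by (intro exI[of _ "1\<^sub>m 0"] exI[of _ 0] exI[of _ "0\<^sub>m 0 0"])
       (auto simp: unitary_mat_def inverts_mat_def intro!: eq_matI)
next
  case (Suc n)
  show ?case
  proof (cases "\<exists>e. eigenvalue A e \<and> e \<noteq> 0")
    case False
    then obtain m where "A ^\<^sub>m m = 0\<^sub>m (Suc n) (Suc n)"
      using nilpotent_if_eigenvalues_zero[OF Suc.prems] by blast
    \<comment> \<open>Here \<open>r = 0\<close>: the empty block \<open>T\<close> has determinant 1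
      and so counts as non-singular.\<close>
    moreover have "A = 1\<^sub>m (Suc n) *
        four_block_mat (1\<^sub>m 0) (0\<^sub>m 0 (Suc n)) (0\<^sub>m (Suc n) 0) A * mat_adjoint (1\<^sub>m (Suc n))"
      using Suc.prems four_block_carrier_mat[of "1\<^sub>m 0" 0 0 A "Suc n" "Suc n"]
      by (simp, intro eq_matI) auto
    moreover have "unitary_mat (1\<^sub>m (Suc n))"
      by (simp add: unitary_mat_def inverts_mat_def)
    moreover have "det (1\<^sub>m 0 :: complex mat) \<noteq> 0" "0 + Suc n = Suc n" by simp_all
    ultimately show ?thesis
      using Suc.prems one_carrier_mat zero_carrier_mat by blast
  next
    case True
    then obtain e where e: "eigenvalue A e" "e \<noteq> 0" by blast
    let ?E = "mat 1 1 (\<lambda>_. e)"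
    obtain U b D where U: "U \<in> carrier_mat (Suc n) (Suc n)" "unitary_mat U"
      and b: "b \<in> carrier_mat 1 n" and D: "D \<in> carrier_mat n n"
      and A: "A = U * four_block_mat ?E b (0\<^sub>m n 1) D * mat_adjoint U"
      using unitary_eigenvalue_split[OF Suc.prems e(1)] by blast
    obtain V r s T S N m where V: "V \<in> carrier_mat n n" "unitary_mat V" and rs: "r + s = n"
      and T: "T \<in> carrier_mat r r" "det T \<noteq> 0" and S: "S \<in> carrier_mat r s"
      and N: "N \<in> carrier_mat s s" "N ^\<^sub>m m = 0\<^sub>m s s"
      and D': "D = V * four_block_mat T S (0\<^sub>m s r) N * mat_adjoint V"
      using Suc.IH[OF D] by blast
    define W where "W = U * four_block_mat (1\<^sub>m 1) (0\<^sub>m 1 n) (0\<^sub>m n 1) V"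
    let ?F = "four_block_mat T S (0\<^sub>m s r) N"
    have F: "?F \<in> carrier_mat n n" using T N rs by auto
    have VDV: "mat_adjoint V * D * V = ?F"
      unfolding D' by (rule unitary_conj_cancel[OF V F])
    have bV: "b * V \<in> carrier_mat 1 (r + s)" using b V rs by auto
    obtain Q1 Q2 where Q: "Q1 \<in> carrier_mat 1 r" "Q2 \<in> carrier_mat 1 s"
      and bV': "b * V = append_cols Q1 Q2" using append_cols_split[OF bV] .
    have W: "W \<in> carrier_mat (Suc n) (Suc n)" "unitary_mat W"
      unfolding W_def using U V unitary_block_diag[OF V, of 1]
        four_block_carrier_mat[of "1\<^sub>m 1" 1 1 V n n]
      by (auto intro!: unitary_mat_mult)
    have "A = W * four_block_mat ?E (b * V) (0\<^sub>m n 1) (mat_adjoint V * D * V) * mat_adjoint W"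
      unfolding A W_def using b D U V by (intro unitary_block_refine) auto
    also have "four_block_mat ?E (b * V) (0\<^sub>m n 1) (mat_adjoint V * D * V) =
        four_block_mat (four_block_mat ?E Q1 (0\<^sub>m r 1) T) (Q2 @\<^sub>r S) (0\<^sub>m s (1 + r)) N"
      unfolding VDV bV' rs[symmetric] using T S N Q by (intro four_block_regroup) auto
    finally have "A = W * four_block_mat (four_block_mat ?E Q1 (0\<^sub>m r 1) T) (Q2 @\<^sub>r S) (0\<^sub>m s (1 + r)) N
       * mat_adjoint W" .
    moreover have "det (four_block_mat ?E Q1 (0\<^sub>m r 1) T) = det ?E * det T"
      using T Q by (intro det_four_block_mat_lower_left_zero) simp_all
    then have "det (four_block_mat ?E Q1 (0\<^sub>m r 1) T) \<noteq> 0"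
      using e(2) T(2) by (simp add: det_single)
    moreover have "four_block_mat ?E Q1 (0\<^sub>m r 1) T \<in> carrier_mat (1 + r) (1 + r)"
      using T by (intro four_block_carrier_mat) simp_all
    moreover have "Q2 @\<^sub>r S \<in> carrier_mat (1 + r) s"
      using Q S by (intro carrier_append_rows)
    moreover have "1 + r + s = Suc n" using rs by simp
    ultimately show ?thesis using W N by blast
  qed
qed

subsection \<open>The core-EP inverse\<close>

text \<open>
  The condition \<open>A X\<^sup>2 = X\<close> replaces \<open>R(X) \<subseteq> R(A\<^sup>k)\<close>, and \<open>m\<close> need not be the index; the
  conditions are therefore manifestly invariant under unitary similarity.
\<close>

definition core_ep_conditions :: "nat \<Rightarrow> complex mat \<Rightarrow> complex mat \<Rightarrow> bool" where
  "core_ep_conditions n A X \<longleftrightarrow> A \<in> carrier_mat n n \<and> X \<in> carrier_mat n n \<and>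
     X * (A * X) = X \<and> mat_adjoint (A * X) = A * X \<and> A * (X * X) = X \<and>
     (\<exists>m. X * A ^\<^sub>m Suc m = A ^\<^sub>m m)"

text \<open>In block coordinates \<open>A X\<close> becomes the coordinate projection
  \<open>P = diag(1, 0)\<close>; the Hermitian and product conditions reduce to
  \<open>Y P = Y = P Y\<close> and to \<open>P\<close> being self-adjoint.\<close>

lemma core_ep_conditions_unitary_form:
  assumes U: "U \<in> carrier_mat n n" "unitary_mat U" "r + s = n"
    and T: "T \<in> carrier_mat r r" and S: "S \<in> carrier_mat r s" and N: "N \<in> carrier_mat s s"
    and T': "T' \<in> carrier_mat r r" "T * T' = 1\<^sub>m r" "T' * T = 1\<^sub>m r" and m: "N ^\<^sub>m m = 0\<^sub>m s s"
  shows "core_ep_conditions n (U * four_block_mat T S (0\<^sub>m s r) N * mat_adjoint U)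
    (U * four_block_mat T' (0\<^sub>m r s) (0\<^sub>m s r) (0\<^sub>m s s) * mat_adjoint U)"
proof -
  define M where "M = four_block_mat T S (0\<^sub>m s r) N"
  define Y where "Y = four_block_mat T' (0\<^sub>m r s) (0\<^sub>m s r) (0\<^sub>m s s)"
  define P where "P = (four_block_mat (1\<^sub>m r) (0\<^sub>m r s) (0\<^sub>m s r) (0\<^sub>m s s) :: complex mat)"
  let ?A = "U * M * mat_adjoint U" and ?X = "U * Y * mat_adjoint U"
  have M: "M \<in> carrier_mat n n" and Y: "Y \<in> carrier_mat n n" and P: "P \<in> carrier_mat n n"
    using U(3) T N T' by (auto simp: M_def Y_def P_def)
  note assoc = assoc_mult_mat[of _ n n _ n _ n] mult_carrier_mat[of _ n n _ n]
  note conj = unitary_conj_mult[OF U(1,2)]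
  have MY: "M * Y = P" unfolding M_def Y_def P_def using T S N T'
    by (subst mult_four_block_mat[of _ r r _ s _ s _ _ r _ s]) auto
  have YP: "Y * P = Y" unfolding Y_def P_def using T'
    by (subst mult_four_block_mat[of _ r r _ s _ s _ _ r _ s]) auto
  have PY: "P * Y = Y" unfolding Y_def P_def using T'
    by (subst mult_four_block_mat[of _ r r _ s _ s _ _ r _ s]) auto
  have adjP: "mat_adjoint P = P"
    unfolding P_def by (subst mat_adjoint_four_block[of _ r r _ s _ s]) auto
  have AX: "?A * ?X = U * P * mat_adjoint U" by (simp only: conj M Y MY)
  have "?X * (?A * ?X) = ?X" by (simp only: AX conj P Y YP)
  moreover have "?A * (?X * ?X) = (?A * ?X) * ?X"
    using U M Y by (intro assoc_mult_mat[symmetric, of _ n n _ n _ n]) (simp_all add: assoc(2))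
  then have "?A * (?X * ?X) = ?X" by (simp only: AX conj P Y PY)
  moreover have "mat_adjoint (?A * ?X) = ?A * ?X"
    unfolding AX using U P by (simp add: mat_adjoint_mult[of _ n n _ n] assoc adjP)
  moreover have "?X * ?A ^\<^sub>m Suc m = ?A ^\<^sub>m m"
  proof -
    \<comment> \<open>For the nilpotency exponent \<open>m\<close> of \<open>N\<close>, the lower
      block row of \<open>M^m\<close> vanishes, and on the upper block row multiplication by
      \<open>Y M\<close> is the identity.\<close>
    obtain R where R: "R \<in> carrier_mat r s" 
      "M ^\<^sub>m m = four_block_mat (T ^\<^sub>m m) R (0\<^sub>m s r) (N ^\<^sub>m m)"
      using upper_block_pow[OF T S N, of m] unfolding M_def by blast
    have TT: "T' * (T * Z) = Z" if "Z \<in> carrier_mat r c" for Z c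
      using that T T' assoc_mult_mat[of T' r r T r Z c] by simp
    have MR: "M * M ^\<^sub>m m = four_block_mat (T * T ^\<^sub>m m) (T * R) (0\<^sub>m s r) (0\<^sub>m s s)"
      unfolding R(2) m unfolding M_def using T S N R(1)
      by (subst mult_four_block_mat[of _ r r _ s _ s _ _ r _ s]) auto
    have "Y * (M * M ^\<^sub>m m) = M ^\<^sub>m m"
      unfolding MR unfolding R(2) m Y_def using T T' R(1) TT[of "T ^\<^sub>m m" r] TT[OF R(1)]
      by (subst mult_four_block_mat[of _ r r _ s _ s _ _ r _ s]) auto
    then have "Y * M ^\<^sub>m Suc m = M ^\<^sub>m m" by (simp only: pow_mat_Suc_left[OF M])
    then show ?thesis
      unfolding unitary_conj_pow[OF U(1,2) M]
      using conj[OF Y pow_carrier_mat[OF M], of "Suc m"] by (simp only:)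
  qed
  moreover have "?A \<in> carrier_mat n n" "?X \<in> carrier_mat n n"
    using U M Y by (simp_all only: assoc(2) mat_adjoint_carrier)
  ultimately show ?thesis
    unfolding core_ep_conditions_def M_def Y_def by blast
qed

lemma core_ep_conditions_exist:
  assumes "A \<in> carrier_mat n n"
  shows "\<exists>X. core_ep_conditions n A X"
proof -
  obtain U r s T S N m where UA: "U \<in> carrier_mat n n" "unitary_mat U" "r + s = n"
    "T \<in> carrier_mat r r" "S \<in> carrier_mat r s" "N \<in> carrier_mat s s" "det T \<noteq> 0"
    "N ^\<^sub>m m = 0\<^sub>m s s" "A = U * four_block_mat T S (0\<^sub>m s r) N * mat_adjoint U"
    using core_nilpotent_unitary_form[OF assms] by blast
  moreover obtain T' where "T' \<in> carrier_mat r r" "T * T' = 1\<^sub>m r" "T' * T = 1\<^sub>m r"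
    using det_nonzero_iff_inverse[OF UA(4)] UA(7) by blast
  ultimately show ?thesis using core_ep_conditions_unitary_form[OF UA(1-6)] by metis
qed

abbreviation (input) sq :: "nat \<Rightarrow> complex mat \<Rightarrow> bool" where
  "sq n A \<equiv> A \<in> carrier_mat n n"

context
  fixes n :: nat
begin

text \<open>With all dimensions fixed to \<open>n\<close>, the laws for rectangular matrices become
  rewrite rules whose side conditions are easily discharged. They nest products to the right and
  distribute adjoints.\<close>

private lemmas ring_simps =
  assoc_mult_mat[of _ n n _ n _ n] mult_carrier_mat[of _ n n _ n] mat_adjoint_mult[of _ n n _ n]

text \<open>The last two facts repeat \<open>X A X = X\<close> and \<open>A X X = X\<close> with a
  trailing factor, so that they also rewrite inside longer right-nested products.\<close>

lemma core_ep_conditionsD: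
  assumes "core_ep_conditions n A X"
  shows "sq n A" "sq n X" "X * (A * X) = X" "mat_adjoint (A * X) = A * X" "A * (X * X) = X"
    "\<And>Y. sq n Y \<Longrightarrow> X * (A * (X * Y)) = X * Y"
    "\<And>Y. sq n Y \<Longrightarrow> A * (X * (X * Y)) = X * Y"
  using assms
proof -
  note c = assms[unfolded core_ep_conditions_def]
  show A: "sq n A" and X: "sq n X" and 1: "X * (A * X) = X" and "mat_adjoint (A * X) = A * X"
    and 2: "A * (X * X) = X" using c by auto
  show "X * (A * (X * Y)) = X * Y" if "sq n Y" for Y
    using arg_cong[OF 1, of "\<lambda>M. M * Y"] A X that by (simp add: ring_simps)
  show "A * (X * (X * Y)) = X * Y" if "sq n Y" for Y
    using arg_cong[OF 2, of "\<lambda>M. M * Y"] A X that by (simp add: ring_simps)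
qed

text \<open>Substituting \<open>Y = A Y Y\<close> into itself gives \<open>Y = A^k Y^(k+1)\<close>.
  This is the range inclusion for every exponent at once.\<close>

lemma factor_through_power:
  assumes "sq n A" "sq n Y" "A * (Y * Y) = Y"
  shows "\<exists>Z. sq n Z \<and> Y = A ^\<^sub>m k * Z"
proof (induction k)
  case 0
  show ?case using assms by (intro exI[of _ Y]) auto
next
  case (Suc k)
  then obtain Z where Z: "sq n Z" "Y = A ^\<^sub>m k * Z" by blast
  have "Y = A * (A ^\<^sub>m k * Z * Y)" using Z(2) assms(3) by simp
  also have "\<dots> = A ^\<^sub>m Suc k * (Z * Y)"
    using assms Z(1) pow_mat_Suc_left[of A n k] by (simp add: ring_simps del: pow_mat.simps)
  finally show ?case using Z assms by (intro exI[of _ "Z * Y"]) (simp add: ring_simps)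
qed

text \<open>\<open>X * A\<close> fixes every column of \<open>A^k\<close>, hence everything that
  factors through it.\<close>

lemma absorb_power_range:
  assumes "sq n A" "sq n X" "sq n Z" "X * A ^\<^sub>m Suc k = A ^\<^sub>m k" "Y = A ^\<^sub>m k * Z"
  shows "X * (A * Y) = Y"
proof -
  have "X * (A * Y) = (X * A ^\<^sub>m Suc k) * Z"
    using assms(1-3,5) pow_mat_Suc_left[of A n k] by (simp add: ring_simps del: pow_mat.simps)
  then show ?thesis using assms by simp
qed

text \<open>Factoring \<open>Y\<close> through the very exponent that belongs to \<open>X\<close>
  makes the previous fact applicable. The lemma relates solutions of different origin: two for the
  same matrix, or those of two comparable matrices.\<close>

lemma core_ep_absorb:
  assumes "core_ep_conditions n A X" "sq n Y" "A * (Y * Y) = Y"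
  shows "X * (A * Y) = Y"
proof -
  obtain m where m: "X * A ^\<^sub>m Suc m = A ^\<^sub>m m" 
    using assms(1) by (auto simp: core_ep_conditions_def)
  have carrier: "sq n A" "sq n X" using assms(1) by (auto dest: core_ep_conditionsD)
  obtain Z where "sq n Z" "Y = A ^\<^sub>m m * Z" using factor_through_power[of A Y m] assms carrier by blast
  then show ?thesis using absorb_power_range[OF carrier _ m] by blast
qed

text \<open>\<open>(A Y)(A X) = A X\<close> and \<open>(A X)(A Y) = A Y\<close>. Taking the adjoint
  of the first gives \<open>(A X)(A Y) = A X\<close>, so the projections agree, and
  \<open>X = X A X = X A Y = Y\<close>.\<close>

lemma outer_inverse_unique:
  assumes carrier: "sq n A" "sq n X" "sq n Y"
    and X: "mat_adjoint (A * X) = A * X" "X * (A * X) = X" "Y * (A * X) = X"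
    and Y: "mat_adjoint (A * Y) = A * Y" "Y * (A * Y) = Y" "X * (A * Y) = Y"
  shows "X = Y"
proof -
  have "A * X = A * (Y * (A * X))" using X(3) by simp
  also have "\<dots> = mat_adjoint ((A * X) * (A * Y))"
    using carrier X(1) Y(1) mat_adjoint_mult[of "A * X" n n "A * Y" n] by (simp add: ring_simps)
  also have "\<dots> = mat_adjoint (A * (X * (A * Y)))" using carrier by (simp add: ring_simps)
  also have "\<dots> = A * Y" using Y by simp
  finally show ?thesis using X(2) Y(3) by metis
qed

lemma core_ep_conditions_unique:
  assumes X: "core_ep_conditions n A X" and Y: "core_ep_conditions n A Y"
  shows "X = Y"
proof -
  note DX = core_ep_conditionsD[OF X] and DY = core_ep_conditionsD[OF Y]
  show ?thesis
    by (rule outer_inverse_unique[OF DX(1,2) DY(2) DX(4,3) core_ep_absorb[OF Y DX(2,5)]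
          DY(4,3) core_ep_absorb[OF X DY(2,5)]])
qed

text \<open>\<open>A^k\<close> equals \<open>X * A ^ Suc k\<close> and thus lies in the range of
  \<open>X\<close>, on which \<open>A * X\<close> is the identity because
  \<open>A X X = X\<close>.\<close>

lemma core_ep_power_fixed:
  assumes X: "core_ep_conditions n A X" and k: "X * A ^\<^sub>m Suc k = A ^\<^sub>m k"
  shows "A * (X * A ^\<^sub>m k) = A ^\<^sub>m k"
proof -
  note D = core_ep_conditionsD[OF X]
  have "A * (X * A ^\<^sub>m k) = A * (X * (X * A ^\<^sub>m Suc k))" using k by simp
  also have "\<dots> = X * A ^\<^sub>m Suc k" using D(1) by (intro D(7)) auto
  finally show ?thesis using k by simp
qed

section \<open>Index and definite descriptions\<close>

text \<open>The ranges of successive powers are nested, so equal ranks mean equal ranges, and these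
  amount to a factorization.\<close>

lemma rank_pow_Suc_iff:
  assumes A: "sq n A"
  shows "mat_rank (A ^\<^sub>m (k + 1)) = mat_rank (A ^\<^sub>m k) \<longleftrightarrow>
    (\<exists>Y. sq n Y \<and> A ^\<^sub>m k = A ^\<^sub>m Suc k * Y)"
proof -
  have pow: "sq n (A ^\<^sub>m k)" "sq n (A ^\<^sub>m Suc k)" using A by auto
  have sub: "mat_range (A ^\<^sub>m Suc k) \<subseteq> mat_range (A ^\<^sub>m k)"
    unfolding mat_range_subset_iff[OF pow(2,1)] using A by auto
  have "mat_rank (A ^\<^sub>m Suc k) = mat_rank (A ^\<^sub>m k) \<longleftrightarrow>
      mat_range (A ^\<^sub>m k) \<subseteq> mat_range (A ^\<^sub>m Suc k)"
    using range_eq_if_rank_eq[OF pow(2,1) sub] rank_eq_if_range_eq[OF pow(2,1)] sub by blast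
  also have "\<dots> \<longleftrightarrow> (\<exists>Y. sq n Y \<and> A ^\<^sub>m k = A ^\<^sub>m Suc k * Y)"
    unfolding mat_range_subset_iff[OF pow] by blast
  finally show ?thesis by simp
qed

lemma core_invertible_iff: "A \<in> core_invertible n \<longleftrightarrow> sq n A \<and> (\<exists>Y. sq n Y \<and> A = A * (A * Y))"
proof (cases "sq n A")
  case True
  have "A \<in> core_invertible n \<longleftrightarrow> (\<exists>Y. sq n Y \<and> A ^\<^sub>m 1 = A ^\<^sub>m Suc 1 * Y)"
  proof -
    have "A ^\<^sub>m 1 = A" "1 + 1 = (2 :: nat)" using True by simp_all
    then show ?thesis
      using rank_pow_Suc_iff[OF True, of 1] True by (simp only: core_invertible_def) auto
  qed
  also have "\<dots> \<longleftrightarrow> (\<exists>Y. sq n Y \<and> A = A * (A * Y))"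
  proof (intro ex_cong1 conj_cong refl)
    fix Y assume "sq n Y"
    then have "A ^\<^sub>m Suc 1 * Y = A * (A * Y)" "A ^\<^sub>m 1 = A" using True by (simp_all add: ring_simps)
    then show "(A ^\<^sub>m 1 = A ^\<^sub>m Suc 1 * Y) = (A = A * (A * Y))" by (simp only:)
  qed
  finally show ?thesis using True by blast
qed (simp add: core_invertible_def)

text \<open>Transfers the power condition from the unknown exponent \<open>m\<close> to
  \<open>k\<close>: once the ranges stabilize at \<open>k\<close>, \<open>A^k\<close> factors
  through every higher power, in particular through \<open>A^m\<close>, where \<open>X * A\<close>
  is the identity.\<close>

lemma core_ep_power_condition:
  assumes X: "core_ep_conditions n A X" and Y: "sq n Y" "A ^\<^sub>m k = A ^\<^sub>m Suc k * Y"
  shows "X * A ^\<^sub>m Suc k = A ^\<^sub>m k"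
proof -
  note D = core_ep_conditionsD[OF X]
  have "\<exists>W. sq n W \<and> A ^\<^sub>m k = A ^\<^sub>m (m + k) * W" for m
  proof (induction m)
    case 0
    show ?case using D(1) by (intro exI[of _ "1\<^sub>m n"]) auto
  next
    case (Suc m)
    then obtain W where W: "sq n W" "A ^\<^sub>m k = A ^\<^sub>m (m + k) * W" by blast
    have "A ^\<^sub>m (m + k) = A ^\<^sub>m m * (A ^\<^sub>m Suc k * Y)"
      unfolding pow_mat_plus[OF D(1), of m k] using Y(2) by (rule arg_cong)
    also have "\<dots> = A ^\<^sub>m (Suc m + k) * Y"
      using pow_mat_plus[OF D(1), of m "Suc k"] D(1) Y(1)
      by (simp add: ring_simps del: pow_mat.simps)
    finally have "A ^\<^sub>m (m + k) * W = A ^\<^sub>m (Suc m + k) * (Y * W)"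
      using W(1) D(1) Y(1) by (simp add: ring_simps del: pow_mat.simps)
    then have "A ^\<^sub>m k = A ^\<^sub>m (Suc m + k) * (Y * W)" using W(2) by (rule trans[rotated])
    then show ?case using W(1) Y(1) by (intro exI[of _ "Y * W"]) (auto simp: ring_simps)
  qed
  moreover obtain m where m: "X * A ^\<^sub>m Suc m = A ^\<^sub>m m"
    using X by (auto simp: core_ep_conditions_def)
  ultimately obtain W where W: "sq n W" "A ^\<^sub>m k = A ^\<^sub>m (m + k) * W" by blast
  have "A ^\<^sub>m (m + k) * W = A ^\<^sub>m m * (A ^\<^sub>m k * W)"
    using W(1) D(1) by (simp add: pow_mat_plus[OF D(1)] ring_simps)
  with W(2) have "A ^\<^sub>m k = A ^\<^sub>m m * (A ^\<^sub>m k * W)" by (rule trans)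
  then have "X * (A * A ^\<^sub>m k) = A ^\<^sub>m k"
    using W(1) D(1,2) by (intro absorb_power_range[OF _ _ _ m, of "A ^\<^sub>m k * W"]) (auto simp: ring_simps)
  then show ?thesis using pow_mat_Suc_left[OF D(1)] by simp
qed

text \<open>In the singular case \<open>LEAST\<close> needs some exponent at which the rank
  stabilizes. It comes from \<open>X\<close>: \<open>A^m = A X A^m\<close>, and \<open>X\<close>
  factors through arbitrarily high powers of \<open>A\<close>.\<close>

lemma mat_index_power:
  assumes A: "sq n A"
  shows "\<exists>Y. sq n Y \<and> A ^\<^sub>m mat_index A = A ^\<^sub>m Suc (mat_index A) * Y"
proof (cases "invertible_mat A")
  case True
  then obtain Y where "sq n Y" "A * Y = 1\<^sub>m n" using invertible_mat_iff_inverse[OF A] by blast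
  then show ?thesis using True A by (auto simp: mat_index_def intro!: exI[of _ Y])
next
  case False
  obtain X where X: "core_ep_conditions n A X" using core_ep_conditions_exist[OF A] by blast
  note D = core_ep_conditionsD[OF X]
  obtain m where "X * A ^\<^sub>m Suc m = A ^\<^sub>m m" using X by (auto simp: core_ep_conditions_def)
  then have m: "A * (X * A ^\<^sub>m m) = A ^\<^sub>m m" by (rule core_ep_power_fixed[OF X])
  have Am: "sq n (A ^\<^sub>m m)" using A by simp
  obtain Z where Z: "sq n Z" "X = A ^\<^sub>m Suc m * Z"
    using factor_through_power[OF D(1,2,5)] by blast
  have "A ^\<^sub>m Suc m = A * (A * (X * A ^\<^sub>m m))"
    unfolding m by (rule pow_mat_Suc_left[OF A])
  also have "\<dots> = A * A ^\<^sub>m Suc (Suc m) * (Z * A ^\<^sub>m m)"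
    unfolding pow_mat_Suc_left[OF A, of "Suc m"] Z(2) using A Z(1) Am
    by (simp add: ring_simps del: pow_mat.simps)
  finally have *: "A ^\<^sub>m Suc m = A * A ^\<^sub>m Suc (Suc m) * (Z * A ^\<^sub>m m)" .
  have "A * A ^\<^sub>m Suc (Suc m) = A ^\<^sub>m Suc (Suc m) * A"
    using pow_mat_Suc_left[OF A, of "Suc (Suc m)"] by simp
  then have "A ^\<^sub>m Suc m = A ^\<^sub>m Suc (Suc m) * (A * (Z * A ^\<^sub>m m))"
    unfolding * using A Z(1) Am by (simp add: ring_simps del: pow_mat.simps)
  moreover have "sq n (A * (Z * A ^\<^sub>m m))" using A Z(1) Am by (simp add: ring_simps)
  \<comment> \<open>The witness is \<open>Suc m\<close> rather than \<open>m\<close>, because the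
    index of a singular matrix is sought among positive numbers.\<close>
  ultimately have "mat_rank (A ^\<^sub>m (Suc m + 1)) = mat_rank (A ^\<^sub>m Suc m)"
    unfolding rank_pow_Suc_iff[OF A] by blast
  then have "0 < mat_index A \<and> mat_rank (A ^\<^sub>m (mat_index A + 1)) = mat_rank (A ^\<^sub>m mat_index A)"
    using False unfolding mat_index_def by (simp only: if_False) (rule LeastI[of _ "Suc m"], blast)
  then show ?thesis unfolding rank_pow_Suc_iff[OF A] by blast
qed

lemma core_ep_index_condition:
  assumes X: "core_ep_conditions n A X"
  shows "X * A ^\<^sub>m Suc (mat_index A) = A ^\<^sub>m mat_index A"
  using core_ep_power_condition[OF X] mat_index_power[OF core_ep_conditionsD(1)[OF X]] by blast

text \<open>Any candidate \<open>Y\<close> factors through \<open>A^k\<close> by its range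
  condition, as \<open>X\<close> does, and both satisfy the power condition at the index k. Each
  therefore absorbs the other, and \<open>outer_inverse_unique\<close> applies.\<close>

lemma core_ep_inverse_eq:
  assumes X: "core_ep_conditions n A X"
  shows "core_ep_inverse A = X"
proof -
  note D = core_ep_conditionsD[OF X]
  let ?k = "mat_index A"
  have dim: "dim_row A = n" using D(1) by simp
  have Ak: "sq n (A ^\<^sub>m ?k)" using D(1) by simp
  have assoc: "Y * A * Y = Y * (A * Y)" if "sq n Y" for Y
    using D(1) that by (simp add: ring_simps)
  show ?thesis
    unfolding core_ep_inverse_def dim
  proof (rule the_equality)
    show "sq n X \<and> X * A ^\<^sub>m (?k + 1) = A ^\<^sub>m ?k \<and> X * A * X = X \<and>
        mat_adjoint (A * X) = A * X \<and> mat_range X \<subseteq> mat_range (A ^\<^sub>m ?k)"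
      using D core_ep_index_condition[OF X] assoc factor_through_power[OF D(1,2,5), of ?k]
      unfolding mat_range_subset_iff[OF D(2) Ak] Suc_eq_plus1 by auto
  next
    fix Y
    assume Y: "sq n Y \<and> Y * A ^\<^sub>m (?k + 1) = A ^\<^sub>m ?k \<and> Y * A * Y = Y \<and>
        mat_adjoint (A * Y) = A * Y \<and> mat_range Y \<subseteq> mat_range (A ^\<^sub>m ?k)"
    then have sqY: "sq n Y" and Yk: "Y * A ^\<^sub>m Suc ?k = A ^\<^sub>m ?k" by simp_all
    obtain Z where Z: "sq n Z" "Y = A ^\<^sub>m ?k * Z"
      using Y mat_range_subset_iff[OF sqY Ak] by blast
    obtain W where W: "sq n W" "X = A ^\<^sub>m ?k * W"
      using factor_through_power[OF D(1,2,5)] by blast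
    have "X * (A * Y) = Y"
      by (rule absorb_power_range[OF D(1,2) Z(1) core_ep_index_condition[OF X] Z(2)])
    moreover have "Y * (A * X) = X"
      by (rule absorb_power_range[OF D(1) sqY W(1) Yk W(2)])
    ultimately show "Y = X"
      using Y D assoc[OF sqY] by (intro outer_inverse_unique[of A Y X]) auto
  qed
qed

section \<open>Core-invertible matrices and the core inverse\<close>

text \<open>Core-invertibility is stabilization at exponent 1, so both identities are the power
  facts for \<open>k = 1\<close>.\<close>

lemma core_invertibleD:
  assumes "A \<in> core_invertible n" "core_ep_conditions n A X"
  shows "X * (A * A) = A" "A * (X * A) = A"
proof -
  note D = core_ep_conditionsD[OF assms(2)]
  obtain Y where Y: "sq n Y" "A = A * (A * Y)" using assms(1) core_invertible_iff by blast
  have A1: "A ^\<^sub>m 1 = A" "A ^\<^sub>m Suc 1 = A * A" using D(1) by simp_all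
  have "A ^\<^sub>m 1 = A ^\<^sub>m Suc 1 * Y" unfolding A1 using D(1) Y by (simp add: ring_simps)
  from core_ep_power_condition[OF assms(2) Y(1) this]
  have *: "X * A ^\<^sub>m Suc 1 = A ^\<^sub>m 1" .
  show "X * (A * A) = A" using * unfolding A1 .
  show "A * (X * A) = A" using core_ep_power_fixed[OF assms(2) *] unfolding A1 .
qed

text \<open>The adjoint of the left-sided identity \<open>X A A = A\<close> is the right-sided
  factorization that core-invertibility of the adjoint asks for.\<close>

lemma core_invertible_adjoint:
  assumes "A \<in> core_invertible n"
  shows "mat_adjoint A \<in> core_invertible n"
proof -
  have A: "sq n A" using assms core_invertible_iff by blast
  obtain X where X: "core_ep_conditions n A X" using core_ep_conditions_exist[OF A] by blast
  have "sq n X" using core_ep_conditionsD[OF X] by blast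
  moreover have "mat_adjoint A = mat_adjoint (X * (A * A))"
    using core_invertibleD(1)[OF assms X] by simp
  ultimately have "mat_adjoint A = mat_adjoint A * (mat_adjoint A * mat_adjoint X)"
    using A by (simp add: ring_simps)
  then show ?thesis using A \<open>sq n X\<close> core_invertible_iff by blast
qed

text \<open>A matrix \<open>Z\<close> with \<open>A\<^sup>* Z\<close> Hermitian and \<open>A\<^sup>* Z A\<^sup>* = A\<^sup>*\<close> yields a \<open>{1,4}\<close>-inverse \<open>Z\<^sup>*\<close> of \<open>A\<close>,
  and \<open>Z\<^sup>* A X\<close> is the Moore-Penrose inverse for every \<open>{1,3}\<close>-inverse \<open>X\<close>.\<close>

lemma mp_inverse_core_invertible:
  assumes A: "A \<in> core_invertible n" and X: "core_ep_conditions n A X"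
  shows "A * mp_inverse A = A * X"
proof -
  note D = core_ep_conditionsD[OF X] and C = core_invertibleD[OF A X]
  have dim: "dim_row A = n" "dim_col A = n" using D(1) by auto
  obtain Z where Z: "core_ep_conditions n (mat_adjoint A) Z"
    using core_ep_conditions_exist[of "mat_adjoint A" n] D(1) by auto
  note DZ = core_ep_conditionsD[OF Z]
  define G where "G = mat_adjoint Z"
  have G: "sq n G" using DZ by (simp add: G_def)
  have "mat_adjoint (mat_adjoint A * (Z * mat_adjoint A)) = mat_adjoint (mat_adjoint A)"
    using core_invertibleD(2)[OF core_invertible_adjoint[OF A] Z] by simp
  then have AGA: "A * (G * A) = A"
    using D(1) DZ by (simp add: ring_simps G_def)
  have GA: "mat_adjoint (G * A) = G * A"
  proof -
    have "mat_adjoint (G * A) = mat_adjoint A * Z" "G * A = mat_adjoint (mat_adjoint A * Z)"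
      using D(1) DZ by (simp_all add: ring_simps G_def)
    then show ?thesis using DZ(4) by simp
  qed
  define M where "M = G * (A * X)"
  have M: "sq n M" using D G by (simp add: M_def ring_simps)
  have AM: "A * M = A * X"
  proof -
    have "A * M = A * (G * A) * X" using D G by (simp add: M_def ring_simps)
    then show ?thesis using AGA by simp
  qed
  have MA: "M * A = G * A"
  proof -
    have "M * A = G * (A * (X * A))" using D G by (simp add: M_def ring_simps)
    then show ?thesis using C by simp
  qed
  have "M * A * M = G * (A * M)" unfolding MA using D G M by (simp add: ring_simps)
  then have MAM: "M * A * M = M" unfolding AM by (simp only: M_def)
  have "mp_inverse A = M"
    unfolding mp_inverse_def dim
  proof (rule the_equality)
    have "A * M * A = A * (X * A)" unfolding AM using D by (simp add: ring_simps)
    then show "sq n M \<and> A * M * A = A \<and> M * A * M = M \<and>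
        mat_adjoint (A * M) = A * M \<and> mat_adjoint (M * A) = M * A"
      using M D(4) GA C(2) MAM unfolding AM MA by simp
  next
    fix Y assume "sq n Y \<and> A * Y * A = A \<and> Y * A * Y = Y \<and>
        mat_adjoint (A * Y) = A * Y \<and> mat_adjoint (Y * A) = Y * A"
    then have Y: "sq n Y" "A * Y * A = A" "Y * A * Y = Y" "mat_adjoint (A * Y) = A * Y"
      "mat_adjoint (Y * A) = Y * A" by simp_all
    have AYA: "A * (Y * A) = A" using Y(1,2) D(1) by (simp add: ring_simps)
    have AMA: "A * (M * A) = A" unfolding MA by (rule AGA)
    have sq: "sq n (A * Y)" "sq n (A * M)" "sq n (Y * A)" "sq n (M * A)"
      using D(1) Y(1) M by (simp_all add: ring_simps)
    \<comment> \<open>\<open>A Y = (A M)(A Y)\<close>; both factors are Hermitian, so the adjoint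
      reverses them and \<open>A Y A = A\<close> collapses the product to \<open>A M\<close>. The
      computation of \<open>Y A\<close> below is the mirror image.\<close>
    have "A * Y = A * (M * A) * Y" unfolding AMA ..
    also have "\<dots> = (A * M) * (A * Y)" using D(1) Y(1) M by (simp add: ring_simps)
    also have "\<dots> = mat_adjoint ((A * Y) * (A * M))"
      using sq Y(4) D(4) AM by (simp only: mat_adjoint_mult[of _ n n _ n])
    also have "(A * Y) * (A * M) = A * (Y * A) * M" using D(1) Y(1) M by (simp add: ring_simps)
    also have "mat_adjoint \<dots> = A * M" unfolding AYA AM D(4) ..
    finally have 1: "A * Y = A * M" .
    have "Y * A = Y * (A * (M * A))" unfolding AMA ..
    also have "\<dots> = (Y * A) * (M * A)" using D(1) Y(1) M by (simp add: ring_simps)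
    also have "\<dots> = mat_adjoint ((M * A) * (Y * A))"
      using sq Y(5) GA MA by (simp only: mat_adjoint_mult[of _ n n _ n])
    also have "(M * A) * (Y * A) = M * (A * (Y * A))" using D(1) Y(1) M by (simp add: ring_simps)
    also have "mat_adjoint \<dots> = M * A" unfolding AYA MA GA ..
    finally have 2: "Y * A = M * A" .
    have "Y = (Y * A) * Y" using Y(3) by simp
    also have "\<dots> = M * (A * Y)" unfolding 2 using D(1) Y(1) M by (simp add: ring_simps)
    also have "\<dots> = (M * A) * M" unfolding 1 using D(1) M by (simp add: ring_simps)
    also have "\<dots> = M" by (rule MAM)
    finally show "Y = M" .
  qed
  then show ?thesis using AM by simp
qed

text \<open>\<open>X = A (X X)\<close> gives the range condition. Conversely \<open>X A\<close>
  fixes the range of \<open>A\<close>, so any candidate satisfies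
  \<open>Y = X A Y = X A X = X\<close>.\<close>

lemma core_inverse_eq:
  assumes A: "A \<in> core_invertible n" and X: "core_ep_conditions n A X"
  shows "core_inverse A = X"
proof -
  note D = core_ep_conditionsD[OF X]
  have dim: "dim_row A = n" using D(1) by simp
  have "core_inverse A = (THE Y. sq n Y \<and> A * Y = A * X \<and> mat_range Y \<subseteq> mat_range A)"
    unfolding core_inverse_def dim mp_inverse_core_invertible[OF A X] ..
  also have "\<dots> = X"
  proof (rule the_equality)
    have "sq n (X * X)" using D by (simp add: ring_simps)
    then show "sq n X \<and> A * X = A * X \<and> mat_range X \<subseteq> mat_range A"
      using D unfolding mat_range_subset_iff[OF D(2,1)] by (auto intro!: bexI[of _ "X * X"])
  next
    fix Y assume "sq n Y \<and> A * Y = A * X \<and> mat_range Y \<subseteq> mat_range A"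
    then have Y: "sq n Y" "A * Y = A * X" "mat_range Y \<subseteq> mat_range A" by simp_all
    then obtain W where W: "sq n W" "Y = A * W" using mat_range_subset_iff[OF Y(1) D(1)] by blast
    have "X * (A * Y) = X * (A * A) * W" using D W by (simp add: ring_simps)
    also have "\<dots> = Y" unfolding core_invertibleD[OF A X] W(2) ..
    finally show "Y = X" unfolding Y(2) D(3) by simp
  qed
  finally show ?thesis .
qed

subsection \<open>Core-EP decompositions and orders\<close>

lemma core_ep_le_iff:
  assumes "core_ep_conditions n A X"
  shows "core_ep_le A B \<longleftrightarrow> X * A = X * B \<and> A * X = B * X"
  by (simp add: core_ep_le_def core_ep_inverse_eq[OF assms])

text \<open>\<open>A\<close> commutes with its powers, so it maps the range of \<open>A^m\<close>,
  which contains that of \<open>X\<close>, into itself; \<open>X * A\<close> is the identity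
  there.\<close>

lemma core_ep_absorb_image:
  assumes X: "core_ep_conditions n A X" and Y: "sq n Y"
  shows "X * (A * (A * (X * Y))) = A * (X * Y)"
proof -
  note D = core_ep_conditionsD[OF X]
  obtain m where m: "X * A ^\<^sub>m Suc m = A ^\<^sub>m m"
    using X by (auto simp: core_ep_conditions_def)
  obtain Z where Z: "sq n Z" "X = A ^\<^sub>m m * Z"
    using factor_through_power[OF D(1,2,5)] by blast
  have ZY: "sq n (A * (Z * Y))" using D(1) Z(1) Y by (simp add: ring_simps)
  have "A * (X * Y) = (A * A ^\<^sub>m m) * (Z * Y)"
    unfolding Z(2) using D(1) Z(1) Y by (simp add: ring_simps)
  also have "A * A ^\<^sub>m m = A ^\<^sub>m m * A" using pow_mat_Suc_left[OF D(1), of m] by simp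
  also have "A ^\<^sub>m m * A * (Z * Y) = A ^\<^sub>m m * (A * (Z * Y))"
    using D(1) Z(1) Y by (simp add: ring_simps)
  finally show ?thesis by (rule absorb_power_range[OF D(1,2) ZY m])
qed

lemma core_part_conditions:
  assumes X: "core_ep_conditions n A X"
  shows "core_ep_conditions n (A * (X * A)) X" "A * (X * A) \<in> core_invertible n"
proof -
  note D = core_ep_conditionsD[OF X]
  let ?A1 = "A * (X * A)"
  have A1: "sq n ?A1" using D by (simp add: ring_simps)
  have AX: "?A1 * X = A * X" using D by (simp add: ring_simps)
  have "?A1 * (X * X) = A * X * X" unfolding AX[symmetric] using D A1 by (simp add: ring_simps)
  also have "\<dots> = X" using D by (simp add: ring_simps)
  finally have "?A1 * (X * X) = X" .
  \<comment> \<open>Exponent 1 suffices for the core part, in accordance with its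
    core-invertibility.\<close>
  moreover have "X * ?A1 ^\<^sub>m Suc 1 = ?A1 ^\<^sub>m 1"
  proof -
    have "X * ?A1 ^\<^sub>m Suc 1 = X * (A * (X * (A * (A * (X * A)))))"
      using D A1 by (simp add: ring_simps)
    also have "\<dots> = X * (A * (A * (X * A)))" using D by (simp add: ring_simps)
    also have "\<dots> = ?A1" by (rule core_ep_absorb_image[OF X D(1)])
    finally show ?thesis using A1 by simp
  qed
  ultimately show "core_ep_conditions n ?A1 X"
    unfolding core_ep_conditions_def AX using A1 D by blast
  \<comment> \<open>Since \<open>?A1 X = A X\<close>, the inner product collapses to
    \<open>X A\<close>, and the outer one then to \<open>A X A\<close>.\<close>
  have "?A1 * (?A1 * (X * (X * A))) = ?A1" using D by (simp add: ring_simps)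
  moreover have "sq n (X * (X * A))" using D by (simp add: ring_simps)
  ultimately show "?A1 \<in> core_invertible n" using A1 core_invertible_iff by metis
qed

text \<open>The nilpotent part is \<open>(1 - A X) A\<close>. Orthogonality holds because
  \<open>A X\<close> is a Hermitian idempotent, and \<open>A2 A1 = 0\<close> because
  \<open>A X\<close> fixes \<open>A A X A\<close>.\<close>

lemma core_ep_decomposition_exists:
  assumes X: "core_ep_conditions n A X"
  shows "core_ep_decomposition n A (A * (X * A)) (A - A * (X * A))"
proof -
  note D = core_ep_conditionsD[OF X]
  let ?A1 = "A * (X * A)"
  let ?A2 = "A - ?A1"
  have A1: "sq n ?A1" using D by (simp add: ring_simps)
  then have A2: "sq n ?A2" by (rule minus_carrier_mat)
  have sum: "A = ?A1 + ?A2" using D(1) A1 by (intro eq_matI) auto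
  have "mat_adjoint ?A1 = mat_adjoint (A * X * A)" using D by (simp add: ring_simps)
  also have "\<dots> = mat_adjoint A * (A * X)"
    using D(1,2,4) by (subst mat_adjoint_mult[of _ n n _ n]) (simp_all add: mult_carrier_mat[of _ n n _ n])
  finally have adj: "mat_adjoint ?A1 = mat_adjoint A * (A * X)" .
  have "mat_adjoint ?A1 * ?A2 = mat_adjoint ?A1 * A - mat_adjoint ?A1 * ?A1"
    using D(1) A1 by (intro mult_minus_distrib_mat[of _ n n _ n]) auto
  also have "mat_adjoint ?A1 * ?A1 = mat_adjoint ?A1 * A"
    unfolding adj using D by (simp add: ring_simps)
  finally have ort: "mat_adjoint ?A1 * ?A2 = 0\<^sub>m n n" using D(1) A1 
    by (simp add: minus_r_inv_mat[of _ n n] mult_carrier_mat[of _ n n _ n])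
  have "?A2 * ?A1 = A * ?A1 - ?A1 * ?A1"
    using D(1) A1 by (intro minus_mult_distrib_mat[of _ n n _ _ n]) auto
  also have "?A1 * ?A1 = A * (X * (A * (A * (X * A))))" using D A1 by (simp add: ring_simps)
  also have "\<dots> = A * ?A1" unfolding core_ep_absorb_image[OF X D(1)] ..
  finally have 21: "?A2 * ?A1 = 0\<^sub>m n n" using D(1) A1
    by (simp add: minus_r_inv_mat[of _ n n] mult_carrier_mat[of _ n n _ n])
  have "?A2 * A = ?A2 * ?A1 + ?A2 * ?A2"
    using arg_cong[OF sum, of "(*) ?A2"] mult_add_distrib_mat[OF A2 A1 A2] by simp
  then have A2A: "?A2 * A = ?A2 * ?A2" unfolding 21 using A2 by (simp add: ring_simps)
  \<comment> \<open>\<open>A2 A = A2 A2\<close> lets all factors but the first be replaced by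
    \<open>A\<close>. Thus \<open>A2^(j+1) = (1 - A X) A^(j+1)\<close>, which vanishes when
    \<open>j + 1\<close> is the index.\<close>
  have pow: "?A2 ^\<^sub>m Suc j = ?A2 * A ^\<^sub>m j" for j
  proof (induction j)
    case 0
    show ?case using D(1) A2 by simp
  next
    case (Suc j)
    have "?A2 ^\<^sub>m Suc (Suc j) = ?A2 ^\<^sub>m j * (?A2 * ?A2)" using A2 by (simp add: ring_simps)
    also have "\<dots> = ?A2 ^\<^sub>m Suc j * A" unfolding A2A[symmetric] using D(1) A2 by (simp add: ring_simps)
    also have "\<dots> = ?A2 * A ^\<^sub>m Suc j" unfolding Suc.IH using D(1) A2 by (simp add: ring_simps)
    finally show ?case .
  qed
  let ?k = "mat_index A"
  note fixed = core_ep_power_fixed[OF X core_ep_index_condition[OF X]]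
  have nil: "if ?k = 0 then ?A2 = 0\<^sub>m n n else ?A2 ^\<^sub>m ?k = 0\<^sub>m n n"
  proof (cases ?k)
    case 0
    then have "X * A = 1\<^sub>m n" using core_ep_index_condition[OF X] D(1) by simp
    then show ?thesis using 0 D(1) by (simp add: minus_r_inv_mat[of _ n n])
  next
    case (Suc j)
    have "?A2 * A ^\<^sub>m j = A * A ^\<^sub>m j - ?A1 * A ^\<^sub>m j"
      using D(1) A1 by (intro minus_mult_distrib_mat[of _ n n _ _ n]) auto
    also have "?A1 * A ^\<^sub>m j = A * (X * (A * A ^\<^sub>m j))" using D A1 by (simp add: ring_simps)
    also have "A * A ^\<^sub>m j = A ^\<^sub>m ?k" unfolding Suc by (rule pow_mat_Suc_left[OF D(1), symmetric])
    finally have "?A2 ^\<^sub>m ?k = 0\<^sub>m n n"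
      using D(1) pow[of j] fixed by (simp add: Suc minus_r_inv_mat[of _ n n] mult_carrier_mat[of _ n n _ n])
    then show ?thesis using Suc by simp
  qed
  show ?thesis
    unfolding core_ep_decomposition_def
    using core_part_conditions(2)[OF X] A2 sum nil ort 21 by blast
qed

text \<open>The solution \<open>Z\<close> for \<open>A1\<close> also solves the conditions for
  \<open>A\<close>, so \<open>Z = X\<close> and \<open>A1 = A1 Z A1 = A X A\<close>. The two
  orthogonality relations enter as \<open>Z A2 = 0\<close> and \<open>A2 Z = 0\<close>.\<close>

lemma core_ep_decomposition_unique:
  assumes X: "core_ep_conditions n A X" and dec: "core_ep_decomposition n A A1 A2"
  shows "A1 = A * (X * A)"
proof -
  have c: "A1 \<in> core_invertible n" and A2: "sq n A2" and sum: "A = A1 + A2"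
    and nil: "if mat_index A = 0 then A2 = 0\<^sub>m n n else A2 ^\<^sub>m mat_index A = 0\<^sub>m n n"
    and ort: "mat_adjoint A1 * A2 = 0\<^sub>m n n" and 21: "A2 * A1 = 0\<^sub>m n n"
    using dec by (auto simp: core_ep_decomposition_def)
  have A1: "sq n A1" using c core_invertible_iff by blast
  have A: "sq n A" using A1 A2 sum by simp
  obtain Z where Z: "core_ep_conditions n A1 Z" using core_ep_conditions_exist[OF A1] by blast
  note D = core_ep_conditionsD[OF Z] and C = core_invertibleD[OF c Z]
  \<comment> \<open>Replacing the Hermitian \<open>A1 Z\<close> by its adjoint brings
    \<open>mat_adjoint A1\<close> next to \<open>A2\<close>.\<close>
  have "Z * A2 = Z * (A1 * Z) * A2" using D by (simp only:)
  also have "\<dots> = Z * mat_adjoint (A1 * Z) * A2" using D by (simp only:)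
  also have "\<dots> = Z * (mat_adjoint Z * (mat_adjoint A1 * A2))"
    using D(1,2) A2 by (simp add: ring_simps)
  finally have ZA2: "Z * A2 = 0\<^sub>m n n" unfolding ort using D(2) by simp
  have "A2 * Z = A2 * (A1 * (Z * Z))" using D by (simp only:)
  also have "\<dots> = A2 * A1 * (Z * Z)" using D(1,2) A2 by (simp add: ring_simps)
  finally have A2Z: "A2 * Z = 0\<^sub>m n n" unfolding 21 using D(2) by (simp add: ring_simps)
  have ZA: "Z * A = Z * A1"
    unfolding sum using mult_add_distrib_mat[OF D(2) A1 A2] ZA2 D(1,2) by (simp add: ring_simps)
  have AZ: "A * Z = A1 * Z"
    unfolding sum using add_mult_distrib_mat[OF A1 A2 D(2)] A2Z D(1,2) by (simp add: ring_simps)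
  have A2A: "A2 * A = A2 * A2"
    unfolding sum using mult_add_distrib_mat[OF A2 A1 A2] 21 A2 by (simp add: ring_simps)
  have pow: "A2 * A ^\<^sub>m j = A2 ^\<^sub>m Suc j" for j
  proof (induction j)
    case 0
    show ?case using A A2 by simp
  next
    case (Suc j)
    have "A2 * A ^\<^sub>m Suc j = A2 ^\<^sub>m Suc j * A"
      unfolding Suc.IH[symmetric] using A A2 by (simp add: ring_simps)
    also have "\<dots> = A2 ^\<^sub>m j * (A2 * A)" using A A2 by (simp add: ring_simps)
    also have "\<dots> = A2 ^\<^sub>m Suc (Suc j)" unfolding A2A using A2 by (simp add: ring_simps)
    finally show ?case .
  qed
  have "\<exists>m. Z * A ^\<^sub>m Suc m = A ^\<^sub>m m"
  proof (cases "mat_index A")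
    case 0
    then have "A = A1" using nil sum A1 by simp
    then show ?thesis using C(1) A1 by (intro exI[of _ 1]) (simp add: ring_simps)
  next
    case (Suc j)
    have Aj: "sq n (A ^\<^sub>m j)" using A by simp
    have "A ^\<^sub>m Suc j = A1 * A ^\<^sub>m j + A2 * A ^\<^sub>m j"
      unfolding pow_mat_Suc_left[OF A] using add_mult_distrib_mat[OF A1 A2 Aj] sum by simp
    \<comment> \<open>With \<open>Suc j\<close> the index, \<open>A2 A^j\<close> is the vanishing
      power of \<open>A2\<close>; from there on \<open>A^(j+1)\<close> lies in the range of
      \<open>A1\<close>, where \<open>Z A1\<close> is the identity.\<close>
    then have Ak: "A ^\<^sub>m Suc j = A1 * A ^\<^sub>m j"
      using nil Suc A1 Aj unfolding pow by (simp add: mult_carrier_mat[of _ n n _ n])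
    have "Z * A ^\<^sub>m Suc (Suc j) = Z * A * A ^\<^sub>m Suc j"
      unfolding pow_mat_Suc_left[OF A, of "Suc j"] using A D(2)
      by (simp add: ring_simps del: pow_mat.simps)
    also have "\<dots> = Z * (A1 * A1) * A ^\<^sub>m j" unfolding ZA Ak using D(1,2) Aj by (simp add: ring_simps)
    also have "\<dots> = A ^\<^sub>m Suc j" unfolding C(1) Ak ..
    finally show ?thesis by blast
  qed
  moreover have "A * (Z * Z) = Z"
  proof -
    have "A * (Z * Z) = A * Z * Z" using A D(2) by (simp add: ring_simps)
    also have "\<dots> = A1 * (Z * Z)" unfolding AZ using D(1,2) by (simp add: ring_simps)
    finally show ?thesis using D(5) by simp
  qed
  ultimately have "core_ep_conditions n A Z"
    unfolding core_ep_conditions_def AZ using A D(2,3,4) by blast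
  then have "X = Z" using core_ep_conditions_unique[OF X] by blast
  have "A * (Z * A) = A * Z * A1" unfolding ZA using A D(1,2) by (simp add: ring_simps)
  also have "\<dots> = A1" unfolding AZ using C(2) D(1,2) by (simp add: ring_simps)
  finally show ?thesis unfolding \<open>X = Z\<close> ..
qed

section \<open>Characterizations of the order\<close>

text \<open>With \<open>P = A^k\<close>, the relations \<open>X = P Z\<close> and
  \<open>X A P = P\<close> let \<open>X\<close> and \<open>P\<close> be exchanged as right factors.
  The condition with \<open>X\<close> on the left is moved to the right by an adjoint, as
  \<open>A X\<close> is Hermitian.\<close>

lemma core_ep_le_iff_power:
  assumes A: "sq n A" and B: "sq n B"
  shows "core_ep_le A B \<longleftrightarrow> A ^\<^sub>m (mat_index A + 1) = B * A ^\<^sub>m mat_index A \<and>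
    mat_adjoint A * A ^\<^sub>m mat_index A = mat_adjoint B * A ^\<^sub>m mat_index A"
proof -
  obtain X where X: "core_ep_conditions n A X" using core_ep_conditions_exist[OF A] by blast
  note D = core_ep_conditionsD[OF X]
  define P where "P = A ^\<^sub>m mat_index A"
  have P: "sq n P" using A by (simp add: P_def)
  have Suc: "A ^\<^sub>m (mat_index A + 1) = A * P"
    using pow_mat_Suc_left[OF A, of "mat_index A"] by (simp add: P_def)
  have fixed: "A * (X * P) = P"
    unfolding P_def by (rule core_ep_power_fixed[OF X core_ep_index_condition[OF X]])
  obtain Z where Z: "sq n Z" "X = P * Z"
    unfolding P_def using factor_through_power[OF D(1,2,5)] by blast
  have comm: "A * P = P * A"
    using pow_mat_Suc_left[OF A, of "mat_index A"] by (simp add: P_def)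
  have AX: "A * X = P * (A * Z)"
  proof -
    have "A * X = A * P * Z" unfolding Z(2) using A P Z(1) by (simp add: ring_simps)
    then show ?thesis unfolding comm using A P Z(1) by (simp add: ring_simps)
  qed
  have "A * X = B * X \<longleftrightarrow> A * P = B * P"
  proof
    assume eq: "A * X = B * X"
    have "A * P = A * X * (A * P)"
    proof -
      have "A * X * (A * P) = A * (X * P) * A" using A P D(2) comm by (simp add: ring_simps)
      then show ?thesis using fixed comm by simp
    qed
    also have "\<dots> = B * (X * (A * P))" unfolding eq using A B P D(2) by (simp add: ring_simps)
    also have "X * (A * P) = P"
      using core_ep_index_condition[OF X] pow_mat_Suc_left[OF A, of "mat_index A"] by (simp add: P_def)
    finally show "A * P = B * P" .
  next
    assume "A * P = B * P"
    then have "A * P * Z = B * P * Z" by simp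
    then show "A * X = B * X" unfolding Z(2) using A B P Z(1) by (simp add: ring_simps)
  qed
  moreover have "X * A = X * B \<longleftrightarrow> mat_adjoint A * P = mat_adjoint B * P"
  proof
    assume eq: "X * A = X * B"
    \<comment> \<open>The Hermitian matrix \<open>A X\<close> fixes \<open>P\<close>, so the left
      side depends on \<open>M\<close> only through \<open>X M\<close>.\<close>
    have *: "mat_adjoint M * P = mat_adjoint (A * (X * M)) * P" if "sq n M" for M
    proof -
      have "mat_adjoint (A * (X * M)) = mat_adjoint (A * X * M)"
        using that A D(2) by (simp add: ring_simps)
      also have "\<dots> = mat_adjoint M * (A * X)"
        using that A D(2,4) by (subst mat_adjoint_mult[of _ n n _ n]) (simp_all add: mult_carrier_mat[of _ n n _ n])
      finally have "mat_adjoint (A * (X * M)) * P = mat_adjoint M * (A * (X * P))"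
        using that A P D(2) by (simp add: ring_simps)
      then show ?thesis unfolding fixed by simp
    qed
    show "mat_adjoint A * P = mat_adjoint B * P"
      unfolding *[OF A] *[OF B] eq ..
  next
    assume eq: "mat_adjoint A * P = mat_adjoint B * P"
    \<comment> \<open>Conversely \<open>X M = X (A X M)\<close>, and the adjoint of
      \<open>A X M\<close> is \<open>mat_adjoint M * (A * X)\<close> with
      \<open>A X = P (A Z)\<close>.\<close>
    have *: "X * M = X * mat_adjoint (mat_adjoint M * P * (A * Z))" if "sq n M" for M
    proof -
      have "mat_adjoint M * P * (A * Z) = mat_adjoint M * (A * X)"
        unfolding AX using that A P Z(1) by (simp add: ring_simps)
      then have "mat_adjoint (mat_adjoint M * P * (A * Z)) = A * X * M"
        using that A D(2,4) by (simp add: mat_adjoint_mult[of _ n n _ n] mult_carrier_mat[of _ n n _ n])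
      then show ?thesis using that A D by (simp add: ring_simps)
    qed
    show "X * A = X * B" unfolding *[OF A] *[OF B] eq ..
  qed
  ultimately show ?thesis unfolding core_ep_le_iff[OF X] Suc P_def[symmetric] by blast
qed

lemma core_ep_le_iff_core_parts:
  assumes X: "core_ep_conditions n A X" and Y: "core_ep_conditions n B Y"
  shows "core_ep_le A B \<longleftrightarrow> core_le n (A * (X * A)) (B * (Y * B))"
proof -
  note D = core_ep_conditionsD[OF X] and E = core_ep_conditionsD[OF Y]
  note CX = core_part_conditions[OF X] and CY = core_part_conditions[OF Y]
  let ?B1 = "B * (Y * B)"
  have B1: "sq n ?B1" using E by (simp add: ring_simps)
  have core: "core_le n (A * (X * A)) ?B1 \<longleftrightarrow> X * A = X * ?B1 \<and> A * X = ?B1 * X"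
  proof -
    have "X * (A * (X * A)) = X * A" "A * (X * A) * X = A * X" using D by (simp_all add: ring_simps)
    then show ?thesis
      using CX CY by (simp add: core_le_def core_inverse_eq[OF CX(2,1)])
  qed
  \<comment> \<open>The assumptions give \<open>(B Y)(A X) = A X\<close>; the adjoint swaps the two
    projections, and multiplying by \<open>X\<close> from the left gives the claim.\<close>
  have XBY: "X * (B * Y) = X" if YBX: "Y * (B * X) = X" and AX: "A * X = B * X"
  proof -
    have "B * Y * (A * X) = B * (Y * (B * X))" unfolding AX using D E by (simp add: ring_simps)
    also have "\<dots> = A * X" unfolding YBX AX ..
    finally have "mat_adjoint (B * Y * (A * X)) = A * X" using D(4) by simp
    then have "A * X * (B * Y) = A * X"
      using D(1,2,4) E(1,2,4) by (subst (asm) mat_adjoint_mult[of _ n n _ n]) (simp_all add: mult_carrier_mat[of _ n n _ n])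
    then have "X * (A * X * (B * Y)) = X" using D by simp
    then show ?thesis using D E by (simp add: ring_simps)
  qed
  show ?thesis
    unfolding core_ep_le_iff[OF X] core
  proof safe
    assume XA: "X * A = X * B" and AX: "A * X = B * X"
    have "B * (X * X) = B * X * X" using D E by (simp add: ring_simps)
    also have "\<dots> = X" unfolding AX[symmetric] using D by (simp add: ring_simps)
    finally have YBX: "Y * (B * X) = X" by (rule core_ep_absorb[OF Y D(2)])
    have "?B1 * X = B * (Y * (B * X))" using D E by (simp add: ring_simps)
    then show "A * X = ?B1 * X" unfolding YBX AX by simp
    have "X * ?B1 = X * (B * Y) * B" using D E by (simp add: ring_simps)
    then show "X * A = X * ?B1" unfolding XBY[OF YBX AX] XA by simp
  next
    assume XA: "X * A = X * ?B1" and AX: "A * X = ?B1 * X"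
    have "?B1 * (X * X) = ?B1 * X * X" using D B1 by (simp add: ring_simps)
    also have "\<dots> = X" unfolding AX[symmetric] using D by (simp add: ring_simps)
    \<comment> \<open>\<open>Y\<close> satisfies the conditions for the core part \<open>?B1\<close>
      as well, and \<open>Y ?B1 = Y B\<close>.\<close>
    finally have "Y * (?B1 * X) = X" by (rule core_ep_absorb[OF CY(1) D(2)])
    then have YBX: "Y * (B * X) = X" using D E by (simp add: ring_simps)
    have "?B1 * X = B * (Y * (B * X))" using D E by (simp add: ring_simps)
    then show AX': "A * X = B * X" unfolding AX YBX .
    have "X * ?B1 = X * (B * Y) * B" using D E by (simp add: ring_simps)
    then show "X * A = X * B" unfolding XA XBY[OF YBX AX'] .
  qed
qed

text \<open>Conjugation respects products and adjoints, so each condition is transported by itself,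
  without comparing the indices of the two matrices.\<close>

lemma core_ep_conditions_unitary_conj:
  assumes X: "core_ep_conditions n A X" and V: "sq n V" "unitary_mat V"
  shows "core_ep_conditions n (V * A * mat_adjoint V) (V * X * mat_adjoint V)"
proof -
  note D = core_ep_conditionsD[OF X]
  define f where "f M = V * M * mat_adjoint V" for M
  have f: "sq n (f M)" if "sq n M" for M using that V by (simp add: f_def ring_simps)
  have mult: "f M * f N = f (M * N)" if "sq n M" "sq n N" for M N
    unfolding f_def by (rule unitary_conj_mult[OF V that])
  have adj: "mat_adjoint (f M) = f (mat_adjoint M)" if "sq n M" for M
    using that V by (simp add: f_def ring_simps)
  have sq: "sq n (A * X)" "sq n (X * X)" using D by (simp_all add: ring_simps)
  obtain m where m: "X * A ^\<^sub>m Suc m = A ^\<^sub>m m"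
    using X by (auto simp: core_ep_conditions_def)
  have pow: "f A ^\<^sub>m k = f (A ^\<^sub>m k)" for k
    unfolding f_def by (rule unitary_conj_pow[OF V D(1)])
  have "f X * f A ^\<^sub>m Suc m = f A ^\<^sub>m m"
    unfolding pow mult[OF D(2) pow_carrier_mat[OF D(1)]] m ..
  moreover have "f X * (f A * f X) = f X" "f A * (f X * f X) = f X"
    "mat_adjoint (f A * f X) = f A * f X"
    using D sq by (simp_all only: mult adj)
  ultimately have "core_ep_conditions n (f A) (f X)"
    unfolding core_ep_conditions_def using f[OF D(1)] f[OF D(2)] by blast
  then show ?thesis by (simp only: f_def)
qed

lemma core_ep_le_unitary_conj:
  assumes A: "sq n A" and B: "sq n B" and V: "sq n V" "unitary_mat V" and le: "core_ep_le A B"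
  shows "core_ep_le (V * A * mat_adjoint V) (V * B * mat_adjoint V)"
proof -
  obtain X where X: "core_ep_conditions n A X" using core_ep_conditions_exist[OF A] by blast
  note D = core_ep_conditionsD[OF X]
  have le': "X * A = X * B" "A * X = B * X" using le core_ep_le_iff[OF X] by auto
  show ?thesis
    unfolding core_ep_le_iff[OF core_ep_conditions_unitary_conj[OF X V]]
      unitary_conj_mult[OF V A D(2)] unitary_conj_mult[OF V D(2) A]
      unitary_conj_mult[OF V B D(2)] unitary_conj_mult[OF V D(2) B]
    by (simp only: le')
qed

end

section \<open>The common unitary block form\<close>

lemma four_block_mat_inject:
  fixes P Q R S :: "complex mat"
  assumes "four_block_mat P Q R S = four_block_mat P' Q' R' S'"
    and c: "P \<in> carrier_mat a c" "Q \<in> carrier_mat a d" "R \<in> carrier_mat b c" "S \<in> carrier_mat b d"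
    and c': "P' \<in> carrier_mat a c" "Q' \<in> carrier_mat a d" "R' \<in> carrier_mat b c" "S' \<in> carrier_mat b d"
  shows "P = P'" "Q = Q'" "R = R'" "S = S'"
proof -
  have eq: "four_block_mat P Q R S $$ (i, j) = four_block_mat P' Q' R' S' $$ (i, j)" for i j
    using assms(1) by simp
  show "P = P'"
  proof (rule eq_matI)
    fix i j assume "i < dim_row P'" "j < dim_col P'"
    then show "P $$ (i, j) = P' $$ (i, j)" using eq[of i j] c c' by simp
  qed (use c c' in auto)
  show "Q = Q'"
  proof (rule eq_matI)
    fix i j assume "i < dim_row Q'" "j < dim_col Q'"
    then show "Q $$ (i, j) = Q' $$ (i, j)" using eq[of i "c + j"] c c' by simp
  qed (use c c' in auto)
  show "R = R'"
  proof (rule eq_matI)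
    fix i j assume "i < dim_row R'" "j < dim_col R'"
    then show "R $$ (i, j) = R' $$ (i, j)" using eq[of "a + i" j] c c' by simp
  qed (use c c' in auto)
  show "S = S'"
  proof (rule eq_matI)
    fix i j assume "i < dim_row S'" "j < dim_col S'"
    then show "S $$ (i, j) = S' $$ (i, j)" using eq[of "a + i" "c + j"] c c' by simp
  qed (use c c' in auto)
qed

lemma append_rows_zero: "0\<^sub>m s r @\<^sub>r 0\<^sub>m t r = (0\<^sub>m (s + t) r :: complex mat)"
  by (intro eq_matI) (simp_all add: append_rows_def)

lemma nine_block_mat_upper:
  "nine_block_mat T1 T2 S1 (0\<^sub>m s r) M11 M12 (0\<^sub>m t r) M21 M22 =
    four_block_mat T1 (append_cols T2 S1) (0\<^sub>m (s + t) r) (four_block_mat M11 M12 M21 M22)"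
  by (simp add: nine_block_mat_def append_rows_zero)

text \<open>\<open>X\<close> has only the corner \<open>T'\<close>, so \<open>X B\<close> sees the
  first block row of \<open>B\<close> and \<open>B X\<close> its first block column. Cancelling
  \<open>T'\<close> fixes \<open>P\<close>, \<open>Q\<close> and \<open>R\<close>, while
  \<open>D\<close> is left free.\<close>

lemma core_ep_le_upper_block_iff:
  fixes T S N P Q R D :: "complex mat"
  assumes U: "U \<in> carrier_mat n n" "unitary_mat U" "r + s = n"
    and T: "T \<in> carrier_mat r r" and S: "S \<in> carrier_mat r s" and N: "N \<in> carrier_mat s s"
    and T': "T' \<in> carrier_mat r r" "T * T' = 1\<^sub>m r" "T' * T = 1\<^sub>m r" and m: "N ^\<^sub>m m = 0\<^sub>m s s"
    and B: "P \<in> carrier_mat r r" "Q \<in> carrier_mat r s" "R \<in> carrier_mat s r" "D \<in> carrier_mat s s"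
  shows "core_ep_le (U * four_block_mat T S (0\<^sub>m s r) N * mat_adjoint U)
      (U * four_block_mat P Q R D * mat_adjoint U) \<longleftrightarrow> P = T \<and> Q = S \<and> R = 0\<^sub>m s r"
proof -
  let ?A = "four_block_mat T S (0\<^sub>m s r) N"
  let ?B = "four_block_mat P Q R D"
  let ?Y = "four_block_mat T' (0\<^sub>m r s) (0\<^sub>m s r) (0\<^sub>m s s)"
  have cA: "?A \<in> carrier_mat n n" and cB: "?B \<in> carrier_mat n n" and cY: "?Y \<in> carrier_mat n n"
    using U(3) T N B T' by auto
  have conj_eq: "U * K * mat_adjoint U = U * L * mat_adjoint U \<longleftrightarrow> K = L"
    if "K \<in> carrier_mat n n" "L \<in> carrier_mat n n" for K L
    using unitary_conj_inject[OF U(1,2) that] by blast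
  have YA: "?Y * ?A = four_block_mat (1\<^sub>m r) (T' * S) (0\<^sub>m s r) (0\<^sub>m s s)"
    using T S N T' by (subst mult_four_block_mat[of _ r r _ s _ s _ _ r _ s]) auto
  have YB: "?Y * ?B = four_block_mat (T' * P) (T' * Q) (0\<^sub>m s r) (0\<^sub>m s s)"
    using B T' by (subst mult_four_block_mat[of _ r r _ s _ s _ _ r _ s]) auto
  have AY: "?A * ?Y = four_block_mat (1\<^sub>m r) (0\<^sub>m r s) (0\<^sub>m s r) (0\<^sub>m s s)"
    using T S N T' by (subst mult_four_block_mat[of _ r r _ s _ s _ _ r _ s]) auto
  have BY: "?B * ?Y = four_block_mat (P * T') (0\<^sub>m r s) (R * T') (0\<^sub>m s s)"
    using B T' by (subst mult_four_block_mat[of _ r r _ s _ s _ _ r _ s]) auto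
  have left_cancel: "K = L" if "T' * K = T' * L" "K \<in> carrier_mat r c" "L \<in> carrier_mat r c" for K L c
  proof -
    have "K = T * (T' * K)"
      using that(2) T T' by (simp add: assoc_mult_mat[of T r r T' r _ c, symmetric])
    also have "\<dots> = T * (T' * L)" unfolding that(1) ..
    also have "\<dots> = L"
      using that(3) T T' by (simp add: assoc_mult_mat[of T r r T' r _ c, symmetric])
    finally show ?thesis .
  qed
  have right_cancel: "K = L" if "K * T' = L * T'" "K \<in> carrier_mat c r" "L \<in> carrier_mat c r" for K L c
  proof -
    have "K = K * T' * T" using that(2) T T' by (simp add: assoc_mult_mat[of _ c r T' r T r])
    also have "\<dots> = L * T' * T" unfolding that(1) ..
    also have "\<dots> = L" using that(3) T T' by (simp add: assoc_mult_mat[of _ c r T' r T r])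
    finally show ?thesis .
  qed
  have "core_ep_le (U * ?A * mat_adjoint U) (U * ?B * mat_adjoint U) \<longleftrightarrow>
      ?Y * ?A = ?Y * ?B \<and> ?A * ?Y = ?B * ?Y"
    unfolding core_ep_le_iff[OF core_ep_conditions_unitary_form[OF U T S N T' m]]
      unitary_conj_mult[OF U(1,2) cY cA] unitary_conj_mult[OF U(1,2) cY cB]
      unitary_conj_mult[OF U(1,2) cA cY] unitary_conj_mult[OF U(1,2) cB cY]
    by (simp only: conj_eq[OF mult_carrier_mat[OF cY cA] mult_carrier_mat[OF cY cB]]
        conj_eq[OF mult_carrier_mat[OF cA cY] mult_carrier_mat[OF cB cY]])
  also have "\<dots> \<longleftrightarrow> P = T \<and> Q = S \<and> R = 0\<^sub>m s r"
  proof (intro iffI conjI; (elim conjE)?)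
    assume 1: "?Y * ?A = ?Y * ?B" and 2: "?A * ?Y = ?B * ?Y"
    have "T' * S = T' * Q"
      using 1 unfolding YA YB
      by (rule four_block_mat_inject(2)[OF _ one_carrier_mat mult_carrier_mat[OF T'(1) S] zero_carrier_mat zero_carrier_mat
            mult_carrier_mat[OF T'(1) B(1)] mult_carrier_mat[OF T'(1) B(2)] zero_carrier_mat zero_carrier_mat])
    then show "Q = S" using left_cancel[of S Q s] S B by simp
    have zero: "0\<^sub>m s r = R * T'"
      using 2 unfolding AY BY
      by (rule four_block_mat_inject(3)[OF _ one_carrier_mat zero_carrier_mat zero_carrier_mat zero_carrier_mat
            mult_carrier_mat[OF B(1) T'(1)] zero_carrier_mat mult_carrier_mat[OF B(3) T'(1)] zero_carrier_mat])
    have "R * T' = 0\<^sub>m s r * T'" unfolding zero[symmetric] using T' by simp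
    then show "R = 0\<^sub>m s r" using right_cancel[of R "0\<^sub>m s r" s] B by simp
    have "1\<^sub>m r = P * T'"
      using 2 unfolding AY BY
      by (rule four_block_mat_inject(1)[OF _ one_carrier_mat zero_carrier_mat zero_carrier_mat zero_carrier_mat
            mult_carrier_mat[OF B(1) T'(1)] zero_carrier_mat mult_carrier_mat[OF B(3) T'(1)] zero_carrier_mat])
    then have "P * T' = T * T'" using T' by simp
    then show "P = T" using right_cancel[of P T r] B T by simp
  next
    assume eq: "P = T" "Q = S" "R = 0\<^sub>m s r"
    show "?Y * ?A = ?Y * ?B" using YA YB T'(3) unfolding eq by (simp only:)
    show "?A * ?Y = ?B * ?Y" using AY BY T'(2) left_mult_zero_mat[OF T'(1), of s]
      unfolding eq by (simp only:)
  qed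
  finally show ?thesis .
qed

lemma nilpotent_mat_iff:
  assumes "N \<in> carrier_mat n n"
  shows "nilpotent_mat N \<longleftrightarrow> (\<exists>m. N ^\<^sub>m m = 0\<^sub>m n n)"
  using assms by (auto simp: nilpotent_mat_def)

lemma invertible_mat_iff_det:
  assumes "(A :: complex mat) \<in> carrier_mat n n"
  shows "invertible_mat A \<longleftrightarrow> det A \<noteq> 0"
  using invertible_mat_iff_inverse[OF assms] det_nonzero_iff_inverse[OF assms] by simp

text \<open>Clause (ii) as a single proposition, which the final proof folds. The sizes
  \<open>r\<close>, \<open>s\<close>, \<open>t\<close> are quantified and may be 0, which accounts
  for empty blocks.\<close>

definition common_block_form :: "nat \<Rightarrow> complex mat \<Rightarrow> complex mat \<Rightarrow> bool" where
  "common_block_form n A B \<longleftrightarrow>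
    (\<exists>U r s t T1 T2 S1 T3 S2 N2 N11 N12 N13 N14.
           U \<in> carrier_mat n n \<and> unitary_mat U \<and> r + s + t = n \<and>
           T1 \<in> carrier_mat r r \<and> T2 \<in> carrier_mat r s \<and> S1 \<in> carrier_mat r t \<and>
           T3 \<in> carrier_mat s s \<and> S2 \<in> carrier_mat s t \<and> N2 \<in> carrier_mat t t \<and>
           N11 \<in> carrier_mat s s \<and> N12 \<in> carrier_mat s t \<and>
           N13 \<in> carrier_mat t s \<and> N14 \<in> carrier_mat t t \<and>
           A = U * nine_block_mat T1         T2  S1
                                  (0\<^sub>m s r) N11 N12
                                  (0\<^sub>m t r) N13 N14 * mat_adjoint U \<and>
           B = U * nine_block_mat T1         T2         S1
                                  (0\<^sub>m s r) T3         S2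
                                  (0\<^sub>m t r) (0\<^sub>m t s) N2 * mat_adjoint U \<and>
           nilpotent_mat (four_block_mat N11 N12 N13 N14) \<and> nilpotent_mat N2 \<and>
           invertible_mat T1 \<and> invertible_mat T3)"

lemma core_ep_le_if_common_block_form:
  assumes "common_block_form n A B"
  shows "core_ep_le A B"
proof -
  obtain U r s t T1 T2 S1 T3 S2 N2 N11 N12 N13 N14 where
    U: "U \<in> carrier_mat n n" "unitary_mat U" "r + s + t = n" and
    T: "T1 \<in> carrier_mat r r" and S: "T2 \<in> carrier_mat r s" "S1 \<in> carrier_mat r t" and
    B: "T3 \<in> carrier_mat s s" "S2 \<in> carrier_mat s t" "N2 \<in> carrier_mat t t" and
    N: "N11 \<in> carrier_mat s s" "N12 \<in> carrier_mat s t"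
      "N13 \<in> carrier_mat t s" "N14 \<in> carrier_mat t t" and
    eqA: "A = U * nine_block_mat T1 T2 S1 (0\<^sub>m s r) N11 N12 (0\<^sub>m t r) N13 N14 * mat_adjoint U" and
    eqB: "B = U * nine_block_mat T1 T2 S1 (0\<^sub>m s r) T3 S2 (0\<^sub>m t r) (0\<^sub>m t s) N2 * mat_adjoint U" and
    nil: "nilpotent_mat (four_block_mat N11 N12 N13 N14)" and inv: "invertible_mat T1"
    using assms unfolding common_block_form_def by (elim exE conjE)
  have rst: "r + (s + t) = n" using U by simp
  have cS: "append_cols T2 S1 \<in> carrier_mat r (s + t)" using S by simp
  have cN: "four_block_mat N11 N12 N13 N14 \<in> carrier_mat (s + t) (s + t)"
    using N by simp
  have cD: "four_block_mat T3 S2 (0\<^sub>m t s) N2 \<in> carrier_mat (s + t) (s + t)"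
    using B by simp
  obtain m where m: "four_block_mat N11 N12 N13 N14 ^\<^sub>m m = 0\<^sub>m (s + t) (s + t)"
    using nil nilpotent_mat_iff[OF cN] by blast
  obtain T' where T': "T' \<in> carrier_mat r r" "T1 * T' = 1\<^sub>m r" "T' * T1 = 1\<^sub>m r"
    using inv invertible_mat_iff_inverse[OF T] by blast
  show ?thesis
    unfolding eqA eqB nine_block_mat_upper
      core_ep_le_upper_block_iff[OF U(1,2) rst T cS cN T' m T cS zero_carrier_mat cD]
    by simp
qed

text \<open>The free block \<open>D\<close> of \<open>B\<close> receives a core-nilpotent form of
  its own through \<open>V\<close>. The same \<open>diag(1, V)\<close> replaces the trailing block
  \<open>N\<close> of \<open>A\<close> by a unitarily similar one, which stays nilpotent but has no
  prescribed shape.\<close>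

lemma common_block_form_if_core_ep_le:
  assumes A: "A \<in> carrier_mat n n" and B: "B \<in> carrier_mat n n" and le: "core_ep_le A B"
  shows "common_block_form n A B"
proof -
  obtain U r p T S N m where U: "U \<in> carrier_mat n n" "unitary_mat U" and rp: "r + p = n"
    and T: "T \<in> carrier_mat r r" and S: "S \<in> carrier_mat r p" and N: "N \<in> carrier_mat p p"
    and detT: "det T \<noteq> 0" and m: "N ^\<^sub>m m = 0\<^sub>m p p"
    and eqA: "A = U * four_block_mat T S (0\<^sub>m p r) N * mat_adjoint U"
    using core_nilpotent_unitary_form[OF A] by blast
  obtain T' where T': "T' \<in> carrier_mat r r" "T * T' = 1\<^sub>m r" "T' * T = 1\<^sub>m r"
    using detT det_nonzero_iff_inverse[OF T] by blast
  have "mat_adjoint U * B * U \<in> carrier_mat (r + p) (r + p)"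
    using U B rp by (simp add: mult_carrier_mat[of _ n n _ n])
  then obtain P Q R D where PQ: "P \<in> carrier_mat r r" "Q \<in> carrier_mat r p"
    "R \<in> carrier_mat p r" "D \<in> carrier_mat p p" "mat_adjoint U * B * U = four_block_mat P Q R D"
    by (rule four_block_split)
  have "U * (mat_adjoint U * B * U) * mat_adjoint U = (U * mat_adjoint U) * B * (U * mat_adjoint U)"
    using U B by (simp add: assoc_mult_mat[of _ n n _ n _ n] mult_carrier_mat[of _ n n _ n])
  also have "\<dots> = B" unfolding unitary_matD[OF U] using B by simp
  finally have "B = U * four_block_mat P Q R D * mat_adjoint U" unfolding PQ(5) ..
  with le have "P = T \<and> Q = S \<and> R = 0\<^sub>m p r"
    unfolding eqA using core_ep_le_upper_block_iff[OF U rp T S N T' m PQ(1-4)] by simp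
  with \<open>B = _\<close> have eqB: "B = U * four_block_mat T S (0\<^sub>m p r) D * mat_adjoint U" by simp
  obtain V s t T3 S2 N2 l where V: "V \<in> carrier_mat p p" "unitary_mat V" and st: "s + t = p"
    and T3: "T3 \<in> carrier_mat s s" and S2: "S2 \<in> carrier_mat s t" and N2: "N2 \<in> carrier_mat t t"
    and detT3: "det T3 \<noteq> 0" and l: "N2 ^\<^sub>m l = 0\<^sub>m t t"
    and eqD: "D = V * four_block_mat T3 S2 (0\<^sub>m t s) N2 * mat_adjoint V"
    using core_nilpotent_unitary_form[OF PQ(4)] by blast
  define W where "W = U * four_block_mat (1\<^sub>m r) (0\<^sub>m r p) (0\<^sub>m p r) V"
  have blockV: "four_block_mat (1\<^sub>m r) (0\<^sub>m r p) (0\<^sub>m p r) V \<in> carrier_mat n n"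
    using V rp by auto
  have W: "W \<in> carrier_mat n n" "unitary_mat W"
    unfolding W_def using U V blockV unitary_mat_mult[OF U blockV unitary_block_diag[OF V]] by auto
  have SV: "S * V \<in> carrier_mat r (s + t)" using S V st by auto
  obtain T2 S1 where T2: "T2 \<in> carrier_mat r s" and S1: "S1 \<in> carrier_mat r t"
    and SV_eq: "S * V = append_cols T2 S1" using append_cols_split[OF SV] .
  have VNV: "mat_adjoint V * N * V \<in> carrier_mat (s + t) (s + t)"
    using V N st by (simp add: mult_carrier_mat[of _ p p _ p])
  obtain N11 N12 N13 N14 where N11: "N11 \<in> carrier_mat s s" "N12 \<in> carrier_mat s t"
      "N13 \<in> carrier_mat t s" "N14 \<in> carrier_mat t t"
    and VNV_eq: "mat_adjoint V * N * V = four_block_mat N11 N12 N13 N14"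
    using four_block_split[OF VNV] .
  have U': "U \<in> carrier_mat (r + p) (r + p)" using U rp by simp
  have F: "four_block_mat T3 S2 (0\<^sub>m t s) N2 \<in> carrier_mat p p" using T3 N2 st by auto
  have VDV_eq: "mat_adjoint V * D * V = four_block_mat T3 S2 (0\<^sub>m t s) N2"
    unfolding eqD by (rule unitary_conj_cancel[OF V F])
  have "A = W * nine_block_mat T1 T2 S1 (0\<^sub>m s r) N11 N12 (0\<^sub>m t r) N13 N14 * mat_adjoint W"
    if "T1 = T" for T1
    unfolding that nine_block_mat_upper SV_eq[symmetric] VNV_eq[symmetric] st eqA W_def
    by (rule unitary_block_refine[OF T S N U' V])
  moreover have "B = W * nine_block_mat T1 T2 S1 (0\<^sub>m s r) T3 S2 (0\<^sub>m t r) (0\<^sub>m t s) N2 * mat_adjoint W"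
    if "T1 = T" for T1
    unfolding that nine_block_mat_upper SV_eq[symmetric] VDV_eq[symmetric] st eqB W_def
    by (rule unitary_block_refine[OF T S PQ(4) U' V])
  moreover have "nilpotent_mat (four_block_mat N11 N12 N13 N14)"
  proof -
    have V': "mat_adjoint V \<in> carrier_mat p p" "unitary_mat (mat_adjoint V)"
      using V unitary_matD[OF V] by (auto intro: unitary_matI)
    have "(mat_adjoint V * N * V) ^\<^sub>m m = mat_adjoint V * N ^\<^sub>m m * V"
      using unitary_conj_pow[OF V' N, of m] by simp
    also have "\<dots> = 0\<^sub>m p p" unfolding m using V by simp
    finally show ?thesis
      using nilpotent_mat_iff[OF VNV] unfolding VNV_eq st by blast
  qed
  moreover have "nilpotent_mat N2" using nilpotent_mat_iff[OF N2] l by blast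
  moreover have "invertible_mat T" "invertible_mat T3"
    using invertible_mat_iff_det T T3 detT detT3 by blast+
  moreover have "r + s + t = n" using rp st by simp
  ultimately show ?thesis
    unfolding common_block_form_def using W T T2 S1 T3 S2 N2 N11 by blast
qed

theorem theorem4p2:
  fixes A B :: "complex mat" and n :: nat
  assumes "A \<in> carrier_mat n n" and "B \<in> carrier_mat n n"
  shows
    "(core_ep_le A B \<longleftrightarrow>
        (\<exists>U r s t T1 T2 S1 T3 S2 N2 N11 N12 N13 N14.
           U \<in> carrier_mat n n \<and> unitary_mat U \<and> r + s + t = n \<and>
           T1 \<in> carrier_mat r r \<and> T2 \<in> carrier_mat r s \<and> S1 \<in> carrier_mat r t \<and>
           T3 \<in> carrier_mat s s \<and> S2 \<in> carrier_mat s t \<and> N2 \<in> carrier_mat t t \<and>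
           N11 \<in> carrier_mat s s \<and> N12 \<in> carrier_mat s t \<and>
           N13 \<in> carrier_mat t s \<and> N14 \<in> carrier_mat t t \<and>
           A = U * nine_block_mat T1         T2  S1
                                  (0\<^sub>m s r) N11 N12
                                  (0\<^sub>m t r) N13 N14 * mat_adjoint U \<and>
           B = U * nine_block_mat T1         T2         S1
                                  (0\<^sub>m s r) T3         S2
                                  (0\<^sub>m t r) (0\<^sub>m t s) N2 * mat_adjoint U \<and>
           nilpotent_mat (four_block_mat N11 N12 N13 N14) \<and> nilpotent_mat N2 \<and>
           invertible_mat T1 \<and> invertible_mat T3)) \<and>
     (core_ep_le A B \<longleftrightarrow>
        (A ^\<^sub>m (mat_index A + 1) = B * A ^\<^sub>m mat_index A \<and>
         mat_adjoint A * A ^\<^sub>m mat_index A = mat_adjoint B * A ^\<^sub>m mat_index A)) \<and>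
     (core_ep_le A B \<longleftrightarrow>
        (\<forall>V. V \<in> carrier_mat n n \<and> unitary_mat V \<longrightarrow>
           core_ep_le (V * A * mat_adjoint V) (V * B * mat_adjoint V))) \<and>
     (core_ep_le A B \<longleftrightarrow>
        (\<exists>A1 A2 B1 B2.
           core_ep_decomposition n A A1 A2 \<and> core_ep_decomposition n B B1 B2 \<and>
           core_le n A1 B1))"
  unfolding common_block_form_def[symmetric]
proof (intro conjI)
  show "core_ep_le A B \<longleftrightarrow> common_block_form n A B"
    using core_ep_le_if_common_block_form common_block_form_if_core_ep_le[OF assms] by blast
  show "core_ep_le A B \<longleftrightarrow>
      (A ^\<^sub>m (mat_index A + 1) = B * A ^\<^sub>m mat_index A \<and>
       mat_adjoint A * A ^\<^sub>m mat_index A = mat_adjoint B * A ^\<^sub>m mat_index A)"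
    by (rule core_ep_le_iff_power[OF assms])
  show "core_ep_le A B \<longleftrightarrow>
      (\<forall>V. V \<in> carrier_mat n n \<and> unitary_mat V \<longrightarrow>
         core_ep_le (V * A * mat_adjoint V) (V * B * mat_adjoint V))"
  proof
    assume *: "\<forall>V. V \<in> carrier_mat n n \<and> unitary_mat V \<longrightarrow>
         core_ep_le (V * A * mat_adjoint V) (V * B * mat_adjoint V)"
    have "unitary_mat (1\<^sub>m n)" by (rule unitary_matI[of _ n]) simp_all
    then show "core_ep_le A B" using *[rule_format, of "1\<^sub>m n"] assms by simp
  qed (use core_ep_le_unitary_conj[OF assms] in blast)
  obtain X Y where X: "core_ep_conditions n A X" and Y: "core_ep_conditions n B Y"
    using core_ep_conditions_exist assms by metis
  show "core_ep_le A B \<longleftrightarrow>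
      (\<exists>A1 A2 B1 B2. core_ep_decomposition n A A1 A2 \<and> core_ep_decomposition n B B1 B2 \<and>
         core_le n A1 B1)"
    \<comment> \<open>Existence and uniqueness of the core parts reduce the existential statement to
      the one about \<open>A X A\<close> and \<open>B Y B\<close>.\<close>
    unfolding core_ep_le_iff_core_parts[OF X Y]
    using core_ep_decomposition_exists[OF X] core_ep_decomposition_exists[OF Y]
      core_ep_decomposition_unique[OF X] core_ep_decomposition_unique[OF Y] by metis
qed

end
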